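(* Let $d\geq 3$ be an integer and let $s\in\left(\frac{d}{2},\frac{d+1}{2}\right)$. Then there exists a Borel measure $\mu$ on $\mathbb R^d$ such that $I_s(\mu)\approx 1$ and, for any $\epsilon>0$, $$(\mu\times\mu)\left\{(x,y)\in\mathbb R^d\times\mathbb R^d : 1\leq x\cdot y\leq 1+\epsilon\right\}\approx \epsilon^{\frac{2s}{d+1}}.$$ In particular, $$\limsup_{\epsilon\to 0}\ \epsilon^{-1}(\mu\times\mu)\left\{(x,y)\in\mathbb R^d\times\mathbb R^d : 1\leq x\cdot y\leq 1+\epsilon\right\}=\infty.$$
   Context: For a Borel measure $\mu$ on $\mathbb R^d$, the $s$-energy is $I_s(\mu)=\int\int |x-y|^{-s}\,d\mu(x)\,d\mu(y)$, where $|\cdot|$ is the Euclidean norm; $x\cdot y$ is the standard dot product. The notation $X\lesssim Y$ means that there is a uniform constant $C>0$ (in particular independent of $\epsilon$) with $X\leq CY$, and $X\approx Y$ means that both $X\lesssim Y$ and $Y\lesssim X$. *)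

theory Defs
  imports "HOL-Analysis.Analysis"
begin

text \<open>
  The kernel \<open>|x - y|\<^sup>-\<^sup>s\<close> (for \<open>s > 0\<close>) is \<open>\<infinity>\<close> on the diagonal. This has to be said
  explicitly, because \<open>0 powr (- s) = 0\<close> in HOL; without it a point mass would have energy 0.
\<close>

definition riesz_kernel :: "real \<Rightarrow> 'a::euclidean_space \<Rightarrow> 'a \<Rightarrow> ennreal" where
  "riesz_kernel s x y = (if x = y then \<infinity> else ennreal (norm (x - y) powr (- s)))"

definition riesz_energy :: "real \<Rightarrow> 'a::euclidean_space measure \<Rightarrow> ennreal" where
  "riesz_energy s \<mu> = (\<integral>\<^sup>+ x. \<integral>\<^sup>+ y. riesz_kernel s x y \<partial>\<mu> \<partial>\<mu>)"

text \<open>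
  \<open>X \<approx> Y\<close> with the implied constant exposed, so that its uniformity is expressed by the place of
  the quantifier over \<open>C\<close>.
\<close>

definition comparable :: "real \<Rightarrow> ennreal \<Rightarrow> ennreal \<Rightarrow> bool" where
  "comparable C X Y \<longleftrightarrow> X \<le> ennreal C * Y \<and> Y \<le> ennreal C * X"

definition dot_product_strip :: "real \<Rightarrow> ('a::euclidean_space \<times> 'a) set" where
  "dot_product_strip \<epsilon> = {(x, y). 1 \<le> x \<bullet> y \<and> x \<bullet> y \<le> 1 + \<epsilon>}"

end

theory Submission
  imports Defs
begin

text \<open>
  Split the coordinates other than \<open>e\<close> into two sets \<open>K\<close> and \<open>L\<close> of nearly equal size. If \<open>x\<close> has
  coordinates in \<open>K\<close> only and \<open>y\<close> in \<open>L\<close> only, apart from \<open>x\<^sub>e = 1 + t\<close> and \<open>y\<^sub>e = 1 + u\<close>, then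
  \<open>x \<bullet> y = (1 + t) (1 + u)\<close>. Hence \<open>x \<bullet> y\<close> lies in \<open>[1, 1 + \<epsilon>]\<close> essentially when \<open>t, u \<lesssim> \<epsilon>\<close>, and
  distributing \<open>t\<close> and \<open>u\<close> with \<open>P(t \<le> \<epsilon>) = \<epsilon>\<^sup>\<alpha>\<close>, \<open>P(u \<le> \<epsilon>) = \<epsilon>\<^sup>\<beta>\<close> gives the strip mass \<open>\<epsilon>\<close> to the power
  \<open>\<alpha> + \<beta>\<close>, while the energy is finite for \<open>s < |K| + 2\<alpha>\<close> and \<open>s < |L| + 2\<beta>\<close>. Such exponents with total
  \<open>\<gamma> = 2s / (d + 1)\<close> exist because \<open>s - (d - 1) / 2 < \<gamma>\<close>. As \<open>\<beta> \<le> 1 / 2\<close> may be too restrictive when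
  \<open>|L| < |K|\<close>, the points \<open>y\<close> also receive a coordinate \<open>k0 \<in> K\<close> with distribution \<open>\<epsilon>\<^sup>\<beta>\<close>, and the conditions
  become \<open>\<alpha> + 2\<beta> = \<gamma>\<close> and \<open>s < |L| + 4\<beta>\<close>. Energies factor over the coordinates by
  \<open>|x - y| \<ge> |x\<^sub>i - y\<^sub>i|\<close>.

  For \<open>\<epsilon> \<rightarrow> \<infinity>\<close> the mass must be infinite. A third piece, paired with the first one, spreads mass \<open>T\<^sup>\<gamma>\<close> over
  \<open>{y\<^sub>e \<le> T}\<close>; its energy stays finite because it is sparse in a direction \<open>l0 \<in> L\<close>, invisible to the first piece.
\<close>

subsection \<open>Sums of Borel measures\<close>

text \<open>The sigma-algebra is taken from \<open>M\<close>, so the evaluation lemmas below assume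
  \<open>sets N = sets M\<close>.\<close>

definition add_measure :: "'a measure \<Rightarrow> 'a measure \<Rightarrow> 'a measure" where
  "add_measure M N = measure_of (space M) (sets M) (\<lambda>X. emeasure M X + emeasure N X)"

lemma space_add_measure [simp]: "space (add_measure M N) = space M"
  by (simp add: add_measure_def space_measure_of_conv)

lemma sets_add_measure [simp, measurable_cong]: "sets (add_measure M N) = sets M"
  by (simp add: add_measure_def)

lemma emeasure_add_measure:
  assumes "sets N = sets M" "X \<in> sets M"
  shows "emeasure (add_measure M N) X = emeasure M X + emeasure N X"
  unfolding add_measure_def
proof (rule emeasure_measure_of_sigma)
  show "sigma_algebra (space M) (sets M)" ..
  show "positive (sets M) (\<lambda>X. emeasure M X + emeasure N X)"
    by (simp add: positive_def)
  show "countably_additive (sets M) (\<lambda>X. emeasure M X + emeasure N X)"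
    using assms(1)
    by (intro countably_additiveI) (simp add: suminf_add[symmetric] suminf_emeasure)
qed (use assms in auto)

text \<open>Additivity in the measure holds on indicators and passes to linear combinations; for
  monotone limits both sequences of integrals increase, so their suprema add up.\<close>

lemma nn_integral_add_measure:
  assumes N: "sets N = sets M" and f: "f \<in> borel_measurable M"
  shows "(\<integral>\<^sup>+x. f x \<partial>add_measure M N) = (\<integral>\<^sup>+x. f x \<partial>M) + (\<integral>\<^sup>+x. f x \<partial>N)"
  using f
proof induct
  case (cong f g)
  then show ?case
    using nn_integral_cong[of N f g] nn_integral_cong[of M f g]
      nn_integral_cong[of "add_measure M N" f g] sets_eq_imp_space_eq[OF N] by simp
next
  case (set A)
  then show ?case by (simp add: emeasure_add_measure N)
next
  case (mult u c)
  have "u \<in> borel_measurable N" "u \<in> borel_measurable (add_measure M N)"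
    using mult(2) by (simp_all add: measurable_cong_sets[OF N refl])
  with mult show ?case by (simp add: nn_integral_cmult distrib_left)
next
  case (add u v)
  have "u \<in> borel_measurable N" "u \<in> borel_measurable (add_measure M N)"
       "v \<in> borel_measurable N" "v \<in> borel_measurable (add_measure M N)"
    using add by (simp_all add: measurable_cong_sets[OF N refl])
  with add show ?case by (simp add: nn_integral_add ac_simps)
next
  case (seq U)
  have m: "U i \<in> borel_measurable N" "U i \<in> borel_measurable (add_measure M N)" for i
    using seq by (simp_all add: measurable_cong_sets[OF N refl])
  have inc: "incseq (\<lambda>i. integral\<^sup>N L (U i))" for L
    using seq(4) by (auto simp: mono_def le_fun_def intro!: nn_integral_mono)
  show ?case
    using seq m
    by (simp add: nn_integral_monotone_convergence_SUP image_comp SUP_apply[abs_def]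
        ennreal_SUP_add[OF inc inc])
qed

text \<open>A set of finite \<open>M\<close>-measure and one of finite \<open>N\<close>-measure
  intersect in a set of finite total measure, and the intersections from two countable covers still
  cover.\<close>

lemma sigma_finite_add_measure:
  assumes M: "sigma_finite_measure M" and N: "sigma_finite_measure N" and eq: "sets N = sets M"
  shows "sigma_finite_measure (add_measure M N)"
proof -
  from M obtain A where A: "countable A" "A \<subseteq> sets M" "\<Union>A = space M"
      "\<forall>a\<in>A. emeasure M a \<noteq> \<infinity>"
    unfolding sigma_finite_measure_def by blast
  from N obtain B where B: "countable B" "B \<subseteq> sets M" "\<Union>B = space M"
      "\<forall>b\<in>B. emeasure N b \<noteq> \<infinity>"
    unfolding sigma_finite_measure_def eq sets_eq_imp_space_eq[OF eq] by blast
  let ?C = "(\<lambda>(a, b). a \<inter> b) ` (A \<times> B)"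
  have "emeasure (add_measure M N) (a \<inter> b) \<noteq> \<infinity>" if "a \<in> A" "b \<in> B" for a b
  proof -
    have ab: "a \<in> sets M" "b \<in> sets M" using that A B by auto
    then have "emeasure M (a \<inter> b) \<le> emeasure M a" "emeasure N (a \<inter> b) \<le> emeasure N b"
      by (auto intro!: emeasure_mono simp: eq)
    then have "emeasure (add_measure M N) (a \<inter> b) \<le> emeasure M a + emeasure N b"
      using ab by (simp add: emeasure_add_measure eq sets.Int add_mono)
    also have "\<dots> < \<infinity>" using A(4) B(4) that by (simp add: less_top)
    finally show ?thesis by simp
  qed
  then have fin: "\<forall>c\<in>?C. emeasure (add_measure M N) c \<noteq> \<infinity>" by auto
  have "\<Union>?C = \<Union>A \<inter> \<Union>B" by blast
  then have un: "\<Union>?C = space (add_measure M N)" unfolding A(3) B(3) by simp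
  have "?C \<subseteq> sets (add_measure M N)" using A(2) B(2) by (auto intro!: sets.Int)
  moreover have "countable ?C" using A(1) B(1) by simp
  ultimately show ?thesis
    using fin un unfolding sigma_finite_measure_def by blast
qed

subsection \<open>Images of boxes\<close>

text \<open>Lebesgue measure on the box with sides \<open>S i\<close>, pushed forward by
  \<open>\<phi>\<close>. The parameters are points of a product space and the density is a product
  of indicators, so that integrals of products split into one-dimensional ones.\<close>

definition box_image ::
    "('i \<Rightarrow> real set) \<Rightarrow> (('i::finite \<Rightarrow> real) \<Rightarrow> real ^ 'i) \<Rightarrow> (real ^ 'i) measure" where
  "box_image S \<phi> = distr (density (Pi\<^sub>M UNIV (\<lambda>_. lborel)) (\<lambda>v. \<Prod>i\<in>UNIV. indicator (S i) (v i)))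
     borel \<phi>"

abbreviation coords :: "('i \<Rightarrow> real) measure" where
  "coords \<equiv> Pi\<^sub>M UNIV (\<lambda>_. lborel)"

lemma sets_box_image [simp, measurable_cong]: "sets (box_image S \<phi>) = sets borel"
  by (simp add: box_image_def)

lemma measurable_vec_lambda [measurable (raw)]:
  fixes f :: "'i::finite \<Rightarrow> 'a \<Rightarrow> real"
  assumes "\<And>i. f i \<in> borel_measurable M"
  shows "(\<lambda>x. \<chi> i. f i x) \<in> borel_measurable M"
  by (subst borel_measurable_euclidean_space) (auto simp: Basis_vec_def inner_axis assms)

lemma prod_indicator_UNIV:
  "(\<Prod>i\<in>UNIV. indicator (S i) (v i)) = (indicator {v. \<forall>i. v i \<in> S i} v :: ennreal)"
  for v :: "'i::finite \<Rightarrow> real"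
proof (cases "\<forall>i. v i \<in> S i")
  case False
  then obtain j where "v j \<notin> S j" by blast
  then show ?thesis by (auto simp: indicator_def)
qed auto

lemma nn_integral_box_image:
  assumes [measurable]: "\<And>i. S i \<in> sets borel" "\<phi> \<in> measurable coords borel"
    "f \<in> borel_measurable borel"
  shows "(\<integral>\<^sup>+x. f x \<partial>box_image S \<phi>)
       = (\<integral>\<^sup>+v. indicator {v. \<forall>i. v i \<in> S i} v * f (\<phi> v) \<partial>coords)"
  unfolding box_image_def
  by (subst nn_integral_distr, simp, simp, subst nn_integral_density)
     (simp_all add: prod_indicator_UNIV)

interpretation coords: product_sigma_finite "\<lambda>_. lborel :: real measure"
  by standard

lemma sigma_finite_coords: "sigma_finite_measure (coords :: ('i::finite \<Rightarrow> real) measure)"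
  by (rule coords.sigma_finite) simp

lemma nn_integral_prod_box:
  fixes G :: "'i::finite \<Rightarrow> real \<Rightarrow> ennreal"
  assumes [measurable]: "\<And>i. S i \<in> sets borel" "\<And>i. G i \<in> borel_measurable borel"
  shows "(\<integral>\<^sup>+v. indicator {v. \<forall>i. v i \<in> S i} v * (\<Prod>i\<in>UNIV. G i (v i)) \<partial>coords)
       = (\<Prod>i\<in>UNIV. \<integral>\<^sup>+t. indicator (S i) t * G i t \<partial>lborel)"
  by (subst coords.product_nn_integral_prod[symmetric])
     (simp_all add: prod_indicator_UNIV[symmetric] prod.distrib)

text \<open>The inner integral factors over the coordinates into functions of single coordinates of
  \<open>v\<close>, so the outer integral factors as well.\<close>

lemma nn_integral_box_image_prod:
  fixes G :: "'i::finite \<Rightarrow> real \<Rightarrow> real \<Rightarrow> ennreal"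
  assumes [measurable]: "\<And>i. S i \<in> sets borel" "\<And>i. T i \<in> sets borel"
    "\<And>i. case_prod (G i) \<in> borel_measurable (borel \<Otimes>\<^sub>M borel)"
  shows "(\<integral>\<^sup>+v. \<integral>\<^sup>+w. indicator {v. \<forall>i. v i \<in> S i} v * (indicator {w. \<forall>i. w i \<in> T i} w *
             (\<Prod>i\<in>UNIV. G i (v i) (w i))) \<partial>coords \<partial>coords)
       = (\<Prod>i\<in>UNIV. \<integral>\<^sup>+t. indicator (S i) t * (\<integral>\<^sup>+u. indicator (T i) u * G i t u \<partial>lborel) \<partial>lborel)"
proof -
  have "(\<integral>\<^sup>+w. indicator {v. \<forall>i. v i \<in> S i} v * (indicator {w. \<forall>i. w i \<in> T i} w *
             (\<Prod>i\<in>UNIV. G i (v i) (w i))) \<partial>coords) =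
        indicator {v. \<forall>i. v i \<in> S i} v *
          (\<Prod>i\<in>UNIV. \<integral>\<^sup>+u. indicator (T i) u * G i (v i) u \<partial>lborel)" for v
    by (subst nn_integral_prod_box[symmetric]; (subst nn_integral_cmult)?; simp)
  then show ?thesis
    using nn_integral_prod_box[of S "\<lambda>i t. \<integral>\<^sup>+u. indicator (T i) u * G i t u \<partial>lborel"] by simp
qed

section \<open>Double integrals against images of boxes\<close>

text \<open>Riesz energies and masses of strips are both instances, with the kernel or the indicator
  of the strip as \<open>f\<close>.\<close>

definition pair_integral :: "'a measure \<Rightarrow> 'b measure \<Rightarrow> ('a \<Rightarrow> 'b \<Rightarrow> ennreal) \<Rightarrow> ennreal" where
  "pair_integral M N f = (\<integral>\<^sup>+x. \<integral>\<^sup>+y. f x y \<partial>N \<partial>M)"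

lemma pair_integral_box_image:
  fixes f :: "real ^ 'i \<Rightarrow> real ^ 'i \<Rightarrow> ennreal"
  assumes [measurable]: "\<And>i. S i \<in> sets borel" "\<And>i. T i \<in> sets borel"
    "\<phi> \<in> measurable coords borel" "\<psi> \<in> measurable coords borel"
    "case_prod f \<in> borel_measurable (borel \<Otimes>\<^sub>M borel)"
  shows "pair_integral (box_image S \<phi>) (box_image T \<psi>) f =
     (\<integral>\<^sup>+v. \<integral>\<^sup>+w. indicator {v. \<forall>i. v i \<in> S i} v * (indicator {w. \<forall>i. w i \<in> T i} w *
             f (\<phi> v) (\<psi> w)) \<partial>coords \<partial>coords)"
proof -
  interpret sigma_finite_measure "coords :: ('i \<Rightarrow> real) measure" by (rule sigma_finite_coords)
  show ?thesis
    unfolding pair_integral_def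
    by (subst nn_integral_cmult, measurable, simp add: nn_integral_box_image)
qed

text \<open>Reduction to one coordinate at a time: once \<open>f\<close> is dominated on the boxes
  by a product of functions of the single coordinate pairs, the double integral is at most a product
  of integrals over pairs of real parameters.\<close>

lemma pair_integral_box_image_le:
  fixes f :: "real ^ 'i \<Rightarrow> real ^ 'i \<Rightarrow> ennreal"
  assumes [measurable]: "\<And>i. S i \<in> sets borel" "\<And>i. T i \<in> sets borel"
    "\<phi> \<in> measurable coords borel" "\<psi> \<in> measurable coords borel"
    "case_prod f \<in> borel_measurable (borel \<Otimes>\<^sub>M borel)"
    "\<And>i. case_prod (G i) \<in> borel_measurable (borel \<Otimes>\<^sub>M borel)"
    and le: "\<And>v w. (\<And>i. v i \<in> S i) \<Longrightarrow> (\<And>i. w i \<in> T i) \<Longrightarrow>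
               f (\<phi> v) (\<psi> w) \<le> (\<Prod>i\<in>UNIV. G i (v i) (w i))"
  shows "pair_integral (box_image S \<phi>) (box_image T \<psi>) f \<le>
     (\<Prod>i\<in>UNIV. \<integral>\<^sup>+t. indicator (S i) t * (\<integral>\<^sup>+u. indicator (T i) u * G i t u \<partial>lborel) \<partial>lborel)"
  by (subst pair_integral_box_image, simp_all add: nn_integral_box_image_prod[symmetric])
     (intro nn_integral_mono, auto simp: indicator_def le)

lemma pair_integral_box_image_ge:
  fixes f :: "real ^ 'i \<Rightarrow> real ^ 'i \<Rightarrow> ennreal"
  assumes [measurable]: "\<And>i. S i \<in> sets borel" "\<And>i. T i \<in> sets borel"
    "\<phi> \<in> measurable coords borel" "\<psi> \<in> measurable coords borel"
    "case_prod f \<in> borel_measurable (borel \<Otimes>\<^sub>M borel)"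
    "\<And>i. case_prod (G i) \<in> borel_measurable (borel \<Otimes>\<^sub>M borel)"
    and le: "\<And>v w. (\<And>i. v i \<in> S i) \<Longrightarrow> (\<And>i. w i \<in> T i) \<Longrightarrow>
               (\<Prod>i\<in>UNIV. G i (v i) (w i)) \<le> f (\<phi> v) (\<psi> w)"
  shows "(\<Prod>i\<in>UNIV. \<integral>\<^sup>+t. indicator (S i) t * (\<integral>\<^sup>+u. indicator (T i) u * G i t u \<partial>lborel) \<partial>lborel)
     \<le> pair_integral (box_image S \<phi>) (box_image T \<psi>) f"
  by (subst pair_integral_box_image, simp_all add: nn_integral_box_image_prod[symmetric])
     (intro nn_integral_mono, auto simp: indicator_def le)

subsection \<open>Riesz energies of images of boxes\<close>

lemma measurable_riesz_kernel [measurable]: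
  "case_prod (riesz_kernel s) \<in> borel_measurable (borel \<Otimes>\<^sub>M borel :: ('a::euclidean_space \<times> 'a) measure)"
proof -
  have "{p :: 'a \<times> 'a. fst p = snd p} \<in> sets (borel \<Otimes>\<^sub>M borel)"
    unfolding borel_prod by (intro borel_closed closed_Collect_eq continuous_intros)
  then have [measurable]: "Measurable.pred (borel \<Otimes>\<^sub>M borel) (\<lambda>p :: 'a \<times> 'a. fst p = snd p)"
    by (simp add: pred_def space_pair_measure)
  show ?thesis
    unfolding riesz_kernel_def split_beta' by measurable
qed

lemma borel_measurable_riesz_kernel [measurable (raw)]:
  assumes [measurable]: "f \<in> borel_measurable M" "g \<in> borel_measurable M"
  shows "(\<lambda>x. riesz_kernel s (f x) (g x)) \<in> borel_measurable M"
proof -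
  have "(\<lambda>x. case_prod (riesz_kernel s) (f x, g x)) \<in> borel_measurable M" by measurable
  then show ?thesis by simp
qed

text \<open>Excludes products of 0 and infinity, so that one infinite factor makes a product of
  kernels infinite.\<close>

lemma riesz_kernel_nonzero: "riesz_kernel s x y \<noteq> 0"
  by (simp add: riesz_kernel_def)

lemma riesz_kernel_commute: "riesz_kernel s x y = riesz_kernel s y x"
  by (simp add: riesz_kernel_def norm_minus_commute)

text \<open>The power of \<open>norm (x - y)\<close> splits according to the sum of the exponents,
  and in each factor the norm may be replaced by the smaller
  \<open>\<bar>x $ i - y $ i\<bar>\<close>. If some coordinates in \<open>J\<close> agree, the
  right-hand side is infinite.\<close>

lemma riesz_kernel_le_prod:
  fixes x y :: "real ^ 'n"
  assumes J: "J \<noteq> {}" "\<And>i. i \<in> J \<Longrightarrow> \<sigma> i > 0" and s: "(\<Sum>i\<in>J. \<sigma> i) = s"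
  shows "riesz_kernel s x y \<le> (\<Prod>i\<in>J. riesz_kernel (\<sigma> i) (x $ i) (y $ i))"
proof (cases "\<exists>i\<in>J. x $ i = y $ i")
  case True
  then have "(\<Prod>i\<in>J. riesz_kernel (\<sigma> i) (x $ i) (y $ i)) = top"
    by (auto simp: ennreal_prod_eq_top riesz_kernel_nonzero) (auto simp: riesz_kernel_def)
  then show ?thesis by simp
next
  case False
  then have neq: "x $ i \<noteq> y $ i" if "i \<in> J" for i using that by auto
  with J(1) have xy: "x \<noteq> y" by auto
  have "norm (x - y) powr (- s) = (\<Prod>i\<in>J. norm (x - y) powr (- \<sigma> i))"
    using xy by (subst powr_sum[symmetric]) (auto simp: s[symmetric] sum_negf)
  also have "\<dots> \<le> (\<Prod>i\<in>J. \<bar>x $ i - y $ i\<bar> powr (- \<sigma> i))"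
    using J(2) neq component_le_norm_cart[of "x - y"]
    by (intro prod_mono conjI powr_mono2') (auto simp: less_imp_le)
  finally have "ennreal (norm (x - y) powr (- s)) \<le> (\<Prod>i\<in>J. ennreal (\<bar>x $ i - y $ i\<bar> powr (- \<sigma> i)))"
    by (subst prod_ennreal) (auto intro: ennreal_leI)
  also have "\<dots> = (\<Prod>i\<in>J. riesz_kernel (\<sigma> i) (x $ i) (y $ i))"
    using neq by (intro prod.cong) (auto simp: riesz_kernel_def)
  finally show ?thesis using xy by (simp add: riesz_kernel_def)
qed

lemma nn_integral_powr_from_0:
  fixes \<beta> c :: real
  assumes "\<beta> > -1" "c \<ge> 0"
  shows "(\<integral>\<^sup>+t. indicator {0<..<c} t * ennreal (t powr \<beta>) \<partial>lborel) = ennreal (c powr (\<beta> + 1) / (\<beta> + 1))"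
proof -
  have "((\<lambda>x. x powr \<beta>) has_integral (c powr (\<beta>+1) / (\<beta>+1))) {0<..<c}"
    using has_integral_powr_from_0[OF assms] by (simp add: has_integral_Icc_iff_Ioo)
  from nn_integral_has_integral_lebesgue[OF _ this]
  show ?thesis by (simp add: ennreal_mult ennreal_indicator)
qed

lemma nn_integral_powr_to_inf:
  fixes \<beta> :: real
  assumes "\<beta> < -1"
  shows "(\<integral>\<^sup>+t. indicator {1<..} t * ennreal (t powr \<beta>) \<partial>lborel) < \<infinity>"
proof -
  have "(\<integral>\<^sup>+t. indicator {1<..} t * ennreal (t powr \<beta>) \<partial>lborel)
      \<le> (\<integral>\<^sup>+t. ennreal (indicator {1..} t * t powr \<beta>) \<partial>lborel)"
    by (intro nn_integral_mono) (auto simp: indicator_def)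
  also have "\<dots> = ennreal (- (1 powr (\<beta> + 1)) / (\<beta> + 1))"
    using has_integral_powr_to_inf[OF assms, of 1] by (intro nn_integral_has_integral_lebesgue) auto
  finally show ?thesis by (simp add: order_le_less_trans)
qed

text \<open>The slope bound at the larger point \<open>v\<close> bounds the kernel by a constant
  times \<open>v powr (- (a - 1) * \<sigma>) * (v - w) powr (- \<sigma>)\<close>. Integration over
  \<open>0 < w < v\<close> converges since \<open>\<sigma> < 1\<close> and leaves a multiple of
  \<open>v powr (1 - a * \<sigma>)\<close>, the integrand of the last hypothesis. The half
  \<open>v < w\<close> follows by symmetry.\<close>

lemma riesz_energy_line:
  fixes g :: "real \<Rightarrow> real"
  assumes [measurable]: "S \<in> sets borel" "g \<in> borel_measurable borel"
    and S: "S \<subseteq> {0<..}" and \<kappa>: "\<kappa> > 0" and \<sigma>: "0 < \<sigma>" "\<sigma> < 1"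
    and g: "\<And>v w. v \<in> S \<Longrightarrow> w \<in> S \<Longrightarrow> w < v \<Longrightarrow> \<kappa> * v powr (a - 1) * (v - w) \<le> \<bar>g v - g w\<bar>"
    and fin: "(\<integral>\<^sup>+v. indicator S v * ennreal (v powr (1 - a * \<sigma>)) \<partial>lborel) < \<infinity>"
  shows "(\<integral>\<^sup>+t. indicator S t * (\<integral>\<^sup>+u. indicator S u * riesz_kernel \<sigma> (g t) (g u) \<partial>lborel) \<partial>lborel) < \<infinity>"
proof -
  \<comment> \<open>\<open>H\<close> majorises the kernel where \<open>w < v\<close>. Here
    \<open>w\<close> ranges over all of \<open>{0<..<v}\<close> instead of its part in
    \<open>S\<close>, which makes the inner integral explicit.\<close>
  define H :: "real \<Rightarrow> real \<Rightarrow> ennreal" where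
    "H v w = indicator S v * (ennreal (\<kappa> powr (- \<sigma>) * v powr (- (a - 1) * \<sigma>)) *
       (indicator {0<..<v} w * ennreal ((v - w) powr (- \<sigma>))))" for v w
  have [measurable]: "case_prod H \<in> borel_measurable (borel \<Otimes>\<^sub>M borel)"
  proof -
    have "(\<lambda>p :: real \<times> real. indicator {0<..<fst p} (snd p) :: ennreal) =
        (\<lambda>p. if 0 < snd p \<and> snd p < fst p then 1 else 0)"
      by (auto simp: indicator_def)
    then have [measurable]: "(\<lambda>p :: real \<times> real. indicator {0<..<fst p} (snd p) :: ennreal)
        \<in> borel_measurable (borel \<Otimes>\<^sub>M borel)"
      by simp
    show ?thesis unfolding H_def split_beta' by measurable
  qed
  have ker: "riesz_kernel \<sigma> (g v) (g w) \<le> H v w" if vw: "v \<in> S" "w \<in> S" "w < v" for v w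
  proof -
    have v: "v > 0" "w > 0" using S vw by auto
    have pos: "0 < \<kappa> * v powr (a - 1) * (v - w)" using \<kappa> vw v by simp
    then have ne: "g v \<noteq> g w" using g[OF vw] by auto
    have "\<bar>g v - g w\<bar> powr (- \<sigma>) \<le> (\<kappa> * v powr (a - 1) * (v - w)) powr (- \<sigma>)"
      using g[OF vw] pos \<sigma> by (intro powr_mono2') auto
    also have "\<dots> = \<kappa> powr (- \<sigma>) * (v powr (a - 1)) powr (- \<sigma>) * (v - w) powr (- \<sigma>)"
      using \<kappa> vw v by (simp add: powr_mult)
    also have "(v powr (a - 1)) powr (- \<sigma>) = v powr (- (a - 1) * \<sigma>)"
      by (simp add: powr_powr algebra_simps)
    finally show ?thesis
      using ne vw v \<kappa> by (simp add: H_def riesz_kernel_def ennreal_mult'[symmetric] ennreal_leI)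
  qed
  have int_H: "(\<integral>\<^sup>+w. H v w \<partial>lborel) \<le>
      ennreal (\<kappa> powr (- \<sigma>) / (1 - \<sigma>)) * (indicator S v * ennreal (v powr (1 - a * \<sigma>)))" for v
  proof (cases "v \<in> S")
    case True
    then have v: "v > 0" using S by auto
    \<comment> \<open>The substitution of \<open>v - w\<close> for \<open>w\<close> moves the
      singularity to 0.\<close>
    have "(\<integral>\<^sup>+w. indicator {0<..<v} w * ennreal ((v - w) powr (- \<sigma>)) \<partial>lborel)
        = (\<integral>\<^sup>+w. indicator {0<..<v} (v + (-1) * w) * ennreal ((v - (v + (-1) * w)) powr (- \<sigma>)) \<partial>lborel)"
      by (subst nn_integral_real_affine[where c = "-1" and t = v]) simp_all
    also have "\<dots> = (\<integral>\<^sup>+w. indicator {0<..<v} w * ennreal (w powr (- \<sigma>)) \<partial>lborel)"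
      by (intro nn_integral_cong) (auto simp: indicator_def)
    also have "\<dots> = ennreal (v powr (1 - \<sigma>) / (1 - \<sigma>))"
      using nn_integral_powr_from_0[of "- \<sigma>" v] \<sigma> v by simp
    finally have inner: "(\<integral>\<^sup>+w. indicator {0<..<v} w * ennreal ((v - w) powr (- \<sigma>)) \<partial>lborel)
        = ennreal (v powr (1 - \<sigma>) / (1 - \<sigma>))" .
    have "(\<integral>\<^sup>+w. H v w \<partial>lborel) =
        ennreal (\<kappa> powr (- \<sigma>) * v powr (- (a - 1) * \<sigma>)) * ennreal (v powr (1 - \<sigma>) / (1 - \<sigma>))"
      using True by (simp add: H_def nn_integral_cmult inner)
    also have "\<dots> = ennreal (\<kappa> powr (- \<sigma>) / (1 - \<sigma>)) * ennreal (v powr (- (a - 1) * \<sigma>) * v powr (1 - \<sigma>))"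
      using \<sigma> by (simp add: ennreal_mult'[symmetric] mult_ac)
    also have "v powr (- (a - 1) * \<sigma>) * v powr (1 - \<sigma>) = v powr (1 - a * \<sigma>)"
      by (simp add: powr_add[symmetric] algebra_simps)
    finally show ?thesis using True by simp
  qed (simp add: H_def)
  have "(\<integral>\<^sup>+t. \<integral>\<^sup>+u. H t u \<partial>lborel \<partial>lborel) \<le> (\<integral>\<^sup>+t. ennreal (\<kappa> powr (- \<sigma>) / (1 - \<sigma>)) *
       (indicator S t * ennreal (t powr (1 - a * \<sigma>))) \<partial>lborel)"
    by (intro nn_integral_mono int_H)
  also have "\<dots> < \<infinity>"
    using fin by (simp add: nn_integral_cmult ennreal_mult_less_top)
  finally have H_fin: "(\<integral>\<^sup>+t. \<integral>\<^sup>+u. H t u \<partial>lborel \<partial>lborel) < \<infinity>" .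
  have "(\<integral>\<^sup>+t. indicator S t * (\<integral>\<^sup>+u. indicator S u * riesz_kernel \<sigma> (g t) (g u) \<partial>lborel) \<partial>lborel)
      = (\<integral>\<^sup>+t. \<integral>\<^sup>+u. indicator S t * (indicator S u * riesz_kernel \<sigma> (g t) (g u)) \<partial>lborel \<partial>lborel)"
    by (subst nn_integral_cmult) simp_all
  \<comment> \<open>The kernel is infinite at \<open>u = t\<close>, a null set for each
    \<open>t\<close>; elsewhere one of the two halves applies.\<close>
  also have "\<dots> \<le> (\<integral>\<^sup>+t. \<integral>\<^sup>+u. H t u + H u t \<partial>lborel \<partial>lborel)"
  proof (rule nn_integral_mono, rule nn_integral_mono_AE)
    fix t :: real
    show "AE u in lborel. indicator S t * (indicator S u * riesz_kernel \<sigma> (g t) (g u)) \<le> H t u + H u t"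
      using AE_lborel_singleton[of t]
    proof eventually_elim
      case (elim u)
      then consider "u < t" | "t < u" by linarith
      then show ?case
      proof cases
        case 1
        then show ?thesis using ker[of t u] by (auto simp: indicator_def intro: add_increasing2)
      next
        case 2
        then show ?thesis using ker[of u t] riesz_kernel_commute[of \<sigma> "g u"]
          by (auto simp: indicator_def intro: add_increasing)
      qed
    qed
  qed
  also have "\<dots> = (\<integral>\<^sup>+t. \<integral>\<^sup>+u. H t u \<partial>lborel \<partial>lborel) + (\<integral>\<^sup>+t. \<integral>\<^sup>+u. H u t \<partial>lborel \<partial>lborel)"
    by (subst nn_integral_add[symmetric]; (subst nn_integral_add)?; simp)
  also have "(\<integral>\<^sup>+t. \<integral>\<^sup>+u. H u t \<partial>lborel \<partial>lborel) = (\<integral>\<^sup>+t. \<integral>\<^sup>+u. H t u \<partial>lborel \<partial>lborel)"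
    by (rule lborel_pair.Fubini') simp
  also have "(\<integral>\<^sup>+t. \<integral>\<^sup>+u. H t u \<partial>lborel \<partial>lborel) + (\<integral>\<^sup>+t. \<integral>\<^sup>+u. H t u \<partial>lborel \<partial>lborel) < \<infinity>"
    using H_fin by simp
  finally show ?thesis .
qed

text \<open>Write both powers as \<open>x powr (a - 1) * x\<close> and replace the factor
  \<open>w powr (a - 1)\<close> by the larger \<open>v powr (a - 1)\<close>.\<close>

lemma powr_diff_ge:
  fixes v w a :: real
  assumes "a \<ge> 1" "0 < w" "w < v"
  shows "v powr (a - 1) * (v - w) \<le> v powr a - w powr a"
proof -
  have "w powr a = w powr (a - 1) * w" "v powr a = v powr (a - 1) * v"
    using assms by (simp_all add: powr_diff)
  moreover have "w powr (a - 1) * w \<le> v powr (a - 1) * w"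
    using assms by (intro mult_right_mono powr_mono2) auto
  ultimately show ?thesis by (simp add: algebra_simps)
qed

lemma ennreal_prod_less_top:
  fixes f :: "'a \<Rightarrow> ennreal"
  assumes "\<And>i. f i < top"
  shows "prod f A < top"
  using assms by (metis ennreal_prod_eq_top less_top)

text \<open>The exponent \<open>s\<close> is shared out as \<open>\<sigma> i\<close> over the
  coordinates in \<open>J\<close>, each of which depends on its own parameter alone. A parameter
  outside \<open>J\<close> contributes the square of the length of its interval.\<close>

lemma riesz_energy_box_image:
  fixes \<phi> :: "('n::finite \<Rightarrow> real) \<Rightarrow> real ^ 'n"
  assumes [measurable]: "\<And>i. S i \<in> sets borel" "\<phi> \<in> measurable coords borel"
      "\<And>i. g i \<in> borel_measurable borel"
    and J: "J \<noteq> {}" "\<And>i. i \<in> J \<Longrightarrow> \<sigma> i > 0" "(\<Sum>i\<in>J. \<sigma> i) = s"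
    and \<phi>: "\<And>v i. i \<in> J \<Longrightarrow> \<phi> v $ i = g i (v i)"
    and fin: "\<And>i. i \<in> J \<Longrightarrow> (\<integral>\<^sup>+t. indicator (S i) t *
        (\<integral>\<^sup>+u. indicator (S i) u * riesz_kernel (\<sigma> i) (g i t) (g i u) \<partial>lborel) \<partial>lborel) < \<infinity>"
    and fin': "\<And>i. i \<notin> J \<Longrightarrow> emeasure lborel (S i) < \<infinity>"
  shows "pair_integral (box_image S \<phi>) (box_image S \<phi>) (riesz_kernel s) < \<infinity>"
proof -
  define G where "G i t u = (if i \<in> J then riesz_kernel (\<sigma> i) (g i t) (g i u) else 1)" for i t u
  have "pair_integral (box_image S \<phi>) (box_image S \<phi>) (riesz_kernel s) \<le>
     (\<Prod>i\<in>UNIV. \<integral>\<^sup>+t. indicator (S i) t * (\<integral>\<^sup>+u. indicator (S i) u * G i t u \<partial>lborel) \<partial>lborel)"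
  proof (rule pair_integral_box_image_le)
    show "case_prod (G i) \<in> borel_measurable (borel \<Otimes>\<^sub>M borel)" for i
      by (cases "i \<in> J") (simp_all add: G_def split_beta')
    fix v w
    have "riesz_kernel s (\<phi> v) (\<phi> w) \<le> (\<Prod>i\<in>J. G i (v i) (w i))"
      using riesz_kernel_le_prod[OF J, of "\<phi> v" "\<phi> w"] by (simp add: \<phi> G_def)
    also have "\<dots> = (\<Prod>i\<in>UNIV. G i (v i) (w i))"
      by (rule prod.mono_neutral_left) (auto simp: G_def)
    finally show "riesz_kernel s (\<phi> v) (\<phi> w) \<le> (\<Prod>i\<in>UNIV. G i (v i) (w i))" .
  qed measurable
  also have "\<dots> < top"
  proof -
    have "(\<integral>\<^sup>+t. indicator (S i) t * (\<integral>\<^sup>+u. indicator (S i) u * G i t u \<partial>lborel) \<partial>lborel) < top" for i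
      using fin[of i] fin'[of i]
      by (cases "i \<in> J") (auto simp: G_def nn_integral_multc ennreal_mult_less_top)
    then show ?thesis by (rule ennreal_prod_less_top)
  qed
  finally show ?thesis by simp
qed

section \<open>Symmetry and bilinearity of double integrals\<close>

text \<open>Fubini is applied to the parameters, since \<open>coords\<close> is
  sigma-finite.\<close>

lemma pair_integral_swap_box_image:
  fixes f :: "real ^ 'i \<Rightarrow> real ^ 'i \<Rightarrow> ennreal"
  assumes [measurable]: "\<And>i. S i \<in> sets borel" "\<And>i. T i \<in> sets borel"
    "\<phi> \<in> measurable coords borel" "\<psi> \<in> measurable coords borel"
    "case_prod f \<in> borel_measurable (borel \<Otimes>\<^sub>M borel)"
    and sym: "\<And>x y. f x y = f y x"
  shows "pair_integral (box_image S \<phi>) (box_image T \<psi>) f =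
    pair_integral (box_image T \<psi>) (box_image S \<phi>) f"
proof -
  interpret pair_sigma_finite "coords :: ('i \<Rightarrow> real) measure" "coords :: ('i \<Rightarrow> real) measure"
    by (intro pair_sigma_finite.intro sigma_finite_coords)
  show ?thesis
    by (subst (1 2) pair_integral_box_image; (subst Fubini')?; simp add: mult_ac sym[of "\<phi> _"])
qed

lemma pair_integral_add_measure:
  assumes eq: "sets N = sets M" and M: "sigma_finite_measure M" and N: "sigma_finite_measure N"
    and [measurable]: "case_prod f \<in> borel_measurable (M \<Otimes>\<^sub>M M)"
    and sym: "pair_integral N M f = pair_integral M N f"
  shows "pair_integral (add_measure M N) (add_measure M N) f =
    pair_integral M M f + 2 * pair_integral M N f + pair_integral N N f"
proof -
  interpret M: sigma_finite_measure M by fact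
  interpret N: sigma_finite_measure N by fact
  note [measurable_cong] = eq
  have [simp]: "space N = space M" by (rule sets_eq_imp_space_eq[OF eq])
  have "pair_integral (add_measure M N) (add_measure M N) f =
      (\<integral>\<^sup>+x. (\<integral>\<^sup>+y. f x y \<partial>M) + (\<integral>\<^sup>+y. f x y \<partial>N) \<partial>add_measure M N)"
    unfolding pair_integral_def
    by (intro nn_integral_cong nn_integral_add_measure eq) simp
  also have "\<dots> = (pair_integral M M f + pair_integral M N f) + (pair_integral N M f + pair_integral N N f)"
    unfolding pair_integral_def
    by (subst nn_integral_add_measure[OF eq]; simp add: nn_integral_add)
  finally show ?thesis by (simp add: sym mult_2 ac_simps)
qed

section \<open>Products with few nontrivial factors and integrals over the unit box\<close>

lemma prod_eq_single:
  fixes f :: "'i::finite \<Rightarrow> 'b::comm_monoid_mult"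
  assumes "\<And>i. i \<noteq> a \<Longrightarrow> f i = 1"
  shows "(\<Prod>i\<in>UNIV. f i) = f a"
  using prod.mono_neutral_right[of UNIV "{a}" f] assms by auto

lemma prod_eq_pair:
  fixes f :: "'i::finite \<Rightarrow> 'b::comm_monoid_mult"
  assumes "a \<noteq> b" "\<And>i. i \<noteq> a \<Longrightarrow> i \<noteq> b \<Longrightarrow> f i = 1"
  shows "(\<Prod>i\<in>UNIV. f i) = f a * f b"
  using prod.mono_neutral_right[of UNIV "{a, b}" f] assms by auto

definition unit_box :: "'i \<Rightarrow> real set" where
  "unit_box i = {0<..<1}"

lemma sets_unit_box [simp, measurable]: "unit_box i \<in> sets borel"
  by (simp add: unit_box_def)

lemma nn_integral_indicator_initial:
  fixes c :: real
  assumes "0 \<le> c" "c \<le> 1"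
  shows "(\<integral>\<^sup>+t. indicator {0<..<1} t * indicator {..c} t \<partial>lborel) = ennreal c"
proof -
  \<comment> \<open>For \<open>c = 1\<close> the two sets differ by the point 1, hence equality
    almost everywhere only.\<close>
  have "(\<integral>\<^sup>+t. indicator {0<..<1} t * indicator {..c} t \<partial>lborel) = (\<integral>\<^sup>+t. indicator {0<..c} t \<partial>lborel)"
    using AE_lborel_singleton[of 1] assms
    by (intro nn_integral_cong_AE) (auto elim!: eventually_mono simp: indicator_def)
  then show ?thesis using assms by simp
qed

lemma nn_integral_indicator_initial_le:
  fixes c :: real
  assumes "0 \<le> c"
  shows "(\<integral>\<^sup>+t. indicator {0<..<1} t * indicator {..c} t \<partial>lborel) \<le> ennreal c"
proof -
  have "(\<integral>\<^sup>+t. indicator {0<..<1} t * indicator {..c} t \<partial>lborel) \<le> (\<integral>\<^sup>+t. indicator {0<..c} t \<partial>lborel)"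
    by (intro nn_integral_mono) (auto simp: indicator_def)
  then show ?thesis using assms by simp
qed

text \<open>For \<open>c < 1\<close> both sides are 0, as \<open>ennreal\<close> truncates negative
  numbers.\<close>

lemma nn_integral_indicator_tail:
  "(\<integral>\<^sup>+t. indicator {1<..} t * indicator {..c} t \<partial>lborel) = ennreal (c - 1)"
proof -
  have "(\<integral>\<^sup>+t. indicator {1<..} t * indicator {..c} t \<partial>lborel) = (\<integral>\<^sup>+t. indicator {1<..c} t \<partial>lborel)"
    by (intro nn_integral_cong) (auto simp: indicator_def)
  then show ?thesis by (cases "1 \<le> c") (simp_all add: ennreal_neg)
qed

lemma measurable_indicator_below_powr:
  "(\<lambda>p :: real \<times> real. if snd p \<le> c * fst p powr b then 1 else 0 :: ennreal)
    \<in> borel_measurable (borel \<Otimes>\<^sub>M borel)"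
  by measurable

lemma pair_integral_unit_box_le:
  fixes f :: "real ^ 'i \<Rightarrow> real ^ 'i \<Rightarrow> ennreal"
  assumes [measurable]: "\<phi> \<in> measurable coords borel" "\<psi> \<in> measurable coords borel"
    "case_prod f \<in> borel_measurable (borel \<Otimes>\<^sub>M borel)"
    and le: "\<And>v w. (\<And>i. v i \<in> {0<..<1}) \<Longrightarrow> (\<And>i. w i \<in> {0<..<1}) \<Longrightarrow> f (\<phi> v) (\<psi> w) \<le> c"
  shows "pair_integral (box_image unit_box \<phi>) (box_image unit_box \<psi>) f \<le> c"
proof -
  obtain a :: 'i where True by simp
  \<comment> \<open>The constant is carried by the factor of one arbitrary coordinate
    \<open>a\<close>; all intervals have length 1.\<close>
  define G where "G i t u = (if i = a then c else 1)" for i and t u :: real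
  have "pair_integral (box_image unit_box \<phi>) (box_image unit_box \<psi>) f \<le>
    (\<Prod>i\<in>UNIV. \<integral>\<^sup>+t. indicator (unit_box i) t *
       (\<integral>\<^sup>+u. indicator (unit_box i) u * G i t u \<partial>lborel) \<partial>lborel)"
    by (rule pair_integral_box_image_le) (simp_all add: le unit_box_def G_def prod_eq_single[of a])
  also have "\<dots> = c"
    by (subst prod_eq_single[of a]) (simp_all add: G_def unit_box_def nn_integral_multc)
  finally show ?thesis .
qed

lemma pair_integral_unit_box_ge:
  fixes f :: "real ^ 'i \<Rightarrow> real ^ 'i \<Rightarrow> ennreal"
  assumes [measurable]: "\<phi> \<in> measurable coords borel" "\<psi> \<in> measurable coords borel"
    "case_prod f \<in> borel_measurable (borel \<Otimes>\<^sub>M borel)"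
    and le: "\<And>v w. (\<And>i. v i \<in> {0<..<1}) \<Longrightarrow> (\<And>i. w i \<in> {0<..<1}) \<Longrightarrow> c \<le> f (\<phi> v) (\<psi> w)"
  shows "c \<le> pair_integral (box_image unit_box \<phi>) (box_image unit_box \<psi>) f"
proof -
  obtain a :: 'i where True by simp
  define G where "G i t u = (if i = a then c else 1)" for i and t u :: real
  have "c = (\<Prod>i\<in>UNIV. \<integral>\<^sup>+t. indicator (unit_box i) t *
       (\<integral>\<^sup>+u. indicator (unit_box i) u * G i t u \<partial>lborel) \<partial>lborel)"
    by (subst prod_eq_single[of a]) (simp_all add: G_def unit_box_def nn_integral_multc)
  also have "\<dots> \<le> pair_integral (box_image unit_box \<phi>) (box_image unit_box \<psi>) f"
    by (rule pair_integral_box_image_ge) (simp_all add: le unit_box_def G_def prod_eq_single[of a])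
  finally show ?thesis .
qed

lemma finite_measure_unit_box_image:
  fixes \<phi> :: "('i::finite \<Rightarrow> real) \<Rightarrow> real ^ 'i"
  assumes [measurable]: "\<phi> \<in> measurable coords borel"
  shows "finite_measure (box_image unit_box \<phi>)"
proof
  have "emeasure (box_image unit_box \<phi>) (space (box_image unit_box \<phi>))
      = (\<integral>\<^sup>+x. 1 \<partial>box_image unit_box \<phi>)"
    by simp
  also have "\<dots> = (\<Prod>i\<in>(UNIV :: 'i set). \<integral>\<^sup>+t. indicator (unit_box i) t * 1 \<partial>lborel)"
    by (subst nn_integral_prod_box[symmetric]; (subst nn_integral_box_image)?; simp)
  also have "\<dots> = 1" by (simp add: unit_box_def)
  finally show "emeasure (box_image unit_box \<phi>) (space (box_image unit_box \<phi>)) \<noteq> \<infinity>"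
    by simp
qed

text \<open>On the unit interval \<open>v powr (1 - a * \<sigma>)\<close> is integrable exactly when
  \<open>a * \<sigma> < 2\<close>.\<close>

lemma riesz_energy_unit_interval:
  fixes g :: "real \<Rightarrow> real"
  assumes "g \<in> borel_measurable borel" "\<kappa> > 0" "0 < \<sigma>" "\<sigma> < 1" "a * \<sigma> < 2"
    and g: "\<And>v w. 0 < w \<Longrightarrow> w < v \<Longrightarrow> v < 1 \<Longrightarrow> \<kappa> * v powr (a - 1) * (v - w) \<le> \<bar>g v - g w\<bar>"
  shows "(\<integral>\<^sup>+t. indicator {0<..<1} t *
     (\<integral>\<^sup>+u. indicator {0<..<1} u * riesz_kernel \<sigma> (g t) (g u) \<partial>lborel) \<partial>lborel) < \<infinity>"
  using assms by (intro riesz_energy_line[where \<kappa> = \<kappa> and a = a])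
    (auto simp: nn_integral_powr_from_0)

section \<open>The strip as a symmetric kernel\<close>

definition strip_indicator :: "real \<Rightarrow> real ^ 'n \<Rightarrow> real ^ 'n \<Rightarrow> ennreal" where
  "strip_indicator \<epsilon> x y = indicator (dot_product_strip \<epsilon>) (x, y)"

lemma sets_dot_product_strip [measurable]:
  "dot_product_strip \<epsilon> \<in> sets (borel \<Otimes>\<^sub>M borel :: ((real ^ 'n) \<times> (real ^ 'n)) measure)"
  unfolding dot_product_strip_def borel_prod split_beta'
  by (intro borel_closed closed_Collect_conj closed_Collect_le continuous_intros)

lemma measurable_strip_indicator [measurable]:
  "case_prod (strip_indicator \<epsilon>) \<in> borel_measurable (borel \<Otimes>\<^sub>M borel)"
  unfolding strip_indicator_def split_beta' by simp

lemma strip_indicator_commute: "strip_indicator \<epsilon> x y = strip_indicator \<epsilon> y x"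
  by (simp add: strip_indicator_def indicator_def dot_product_strip_def inner_commute)

lemma strip_indicator_leI:
  assumes "1 \<le> x \<bullet> y \<Longrightarrow> x \<bullet> y \<le> 1 + \<epsilon> \<Longrightarrow> 1 \<le> c"
  shows "strip_indicator \<epsilon> x y \<le> c"
  using assms by (auto simp: strip_indicator_def indicator_def dot_product_strip_def)

lemma strip_indicator_eq_1:
  assumes "1 \<le> x \<bullet> y" "x \<bullet> y \<le> 1 + \<epsilon>"
  shows "strip_indicator \<epsilon> x y = 1"
  using assms by (simp add: strip_indicator_def dot_product_strip_def)

lemma emeasure_strip_eq:
  assumes "sets \<mu> = sets borel" "sigma_finite_measure \<mu>"
  shows "emeasure (\<mu> \<Otimes>\<^sub>M \<mu>) (dot_product_strip \<epsilon>) = pair_integral \<mu> \<mu> (strip_indicator \<epsilon>)"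
proof -
  interpret sigma_finite_measure \<mu> by fact
  note [measurable_cong] = assms(1)
  show ?thesis
    unfolding pair_integral_def strip_indicator_def
    by (rule emeasure_pair_measure) measurable
qed

subsection \<open>The construction\<close>

text \<open>All pieces use coordinate \<open>e\<close>; \<open>k0\<close> is the extra coordinate of
  the second piece, and \<open>l0\<close> the direction in which the unbounded piece is sparse. The
  bounds by 1/2 keep the one-dimensional energy exponents below \<open>2 * \<alpha>\<close> and
  \<open>2 * \<beta>\<close> in the range below 1. The bound \<open>1 / 2 \<le> \<gamma>\<close>
  serves for wide strips and \<open>(d - 1) / 2 < s\<close> for the energy of the unbounded
  piece.\<close>

locale strip_example =
  fixes d s \<gamma> \<alpha> \<beta> :: real and K L :: "'n::finite set" and e k0 l0 :: 'n
  assumes KL: "K \<union> L = - {e}" "K \<inter> L = {}" "k0 \<in> K" "l0 \<in> L"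
    and d: "d = real CARD('n)"
    and \<gamma>: "1 / 2 \<le> \<gamma>" "\<gamma> < 1"
    and \<alpha>: "0 < \<alpha>" "\<alpha> \<le> 1 / 2"
    and \<beta>: "0 < \<beta>" "\<beta> \<le> 1 / 2"
    and \<alpha>\<beta>: "\<alpha> + 2 * \<beta> = \<gamma>"
    and s: "s < real (card K) + 2 * \<alpha>" "s < real (card L) + 4 * \<beta>"
       "(d - 1) / 2 < s" "s < d - 1"
begin

lemma d_gt_1: "d > 1"
  using s(3,4) by simp

lemma s_gt_half: "s > 1 / 2"
proof -
  have "card {e, l0} \<le> CARD('n)" by (rule card_mono) auto
  moreover have "e \<noteq> l0" using KL by auto
  ultimately show ?thesis using s(3) d by simp
qed

lemma distinct [simp]: "e \<noteq> k0" "k0 \<noteq> e" "e \<noteq> l0" "l0 \<noteq> e" "k0 \<noteq> l0" "l0 \<noteq> k0"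
    "e \<notin> K" "e \<notin> L" "k0 \<in> K" "l0 \<in> L" "k0 \<notin> L" "l0 \<notin> K"
  using KL by auto

text \<open>
  On \<open>\<phi>\<^sub>A\<close> and \<open>\<phi>\<^sub>B\<close> the factors \<open>4\<close>, \<open>1 / 4\<close> and \<open>1 / d\<close> keep the two pieces apart and force
  \<open>x \<bullet> y \<ge> 16\<close> within the first piece and \<open>x \<bullet> y < 1\<close> within the second, so that thin strips only see pairs
  of one point from each. The image of \<open>\<phi>\<^sub>D\<close> has infinite measure and accounts for large \<open>\<epsilon>\<close>. The fast
  growth of its coordinate \<open>l0\<close>, which is \<open>0\<close> on the image of \<open>\<phi>\<^sub>A\<close>, makes its energy finite, and the
  factor \<open>8\<close> gives \<open>x \<bullet> y \<ge> 2\<close> for its pairs with the other two pieces.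
\<close>

definition \<phi>\<^sub>A :: "('n \<Rightarrow> real) \<Rightarrow> real ^ 'n" where
  "\<phi>\<^sub>A v = (\<chi> i. if i = e then 4 * (1 + v i powr (1 / \<alpha>)) else if i \<in> K then v i else 0)"

definition \<phi>\<^sub>B :: "('n \<Rightarrow> real) \<Rightarrow> real ^ 'n" where
  "\<phi>\<^sub>B v = (\<chi> i. if i = e then (1 + v i powr (1 / \<beta>)) / 4 else if i = k0 then v i powr (1 / \<beta>) / d
     else if i \<in> L then v i / d else 0)"

definition \<phi>\<^sub>D :: "('n \<Rightarrow> real) \<Rightarrow> real ^ 'n" where
  "\<phi>\<^sub>D v = (\<chi> i. if i = e then 8 * v l0 powr (1 / \<gamma>) else if i = l0 then v i powr 4 else v i)"

text \<open>The side \<open>l0\<close> has infinite length and makes the total mass infinite. Under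
  \<open>\<phi>\<^sub>D\<close>, parameters with \<open>v l0 \<le> T powr \<gamma>\<close> are those
  whose image has coordinate \<open>e\<close> at most \<open>8 * T\<close>.\<close>

definition tail_box :: "'n \<Rightarrow> real set" where
  "tail_box i = (if i = l0 then {1<..} else {0<..<1})"

definition "\<mu>\<^sub>A = box_image unit_box \<phi>\<^sub>A"
definition "\<mu>\<^sub>B = box_image unit_box \<phi>\<^sub>B"
definition "\<mu>\<^sub>D = box_image tail_box \<phi>\<^sub>D"
definition "\<mu> = add_measure (add_measure \<mu>\<^sub>A \<mu>\<^sub>B) \<mu>\<^sub>D"

lemma sets_tail_box [simp, measurable]: "tail_box i \<in> sets borel"
  by (simp add: tail_box_def)

lemma measurable_maps [measurable]:
  "\<phi>\<^sub>A \<in> measurable coords borel" "\<phi>\<^sub>B \<in> measurable coords borel" "\<phi>\<^sub>D \<in> measurable coords borel"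
  unfolding \<phi>\<^sub>A_def \<phi>\<^sub>B_def \<phi>\<^sub>D_def by measurable

lemma sets_components [simp, measurable_cong]:
  "sets \<mu>\<^sub>A = sets borel" "sets \<mu>\<^sub>B = sets borel" "sets \<mu>\<^sub>D = sets borel" "sets \<mu> = sets borel"
  by (simp_all add: \<mu>\<^sub>A_def \<mu>\<^sub>B_def \<mu>\<^sub>D_def \<mu>_def)

lemma sigma_finite_AB: "sigma_finite_measure \<mu>\<^sub>A" "sigma_finite_measure \<mu>\<^sub>B"
  unfolding \<mu>\<^sub>A_def \<mu>\<^sub>B_def
  by (simp_all add: finite_measure_unit_box_image finite_measure.axioms(1))

text \<open>The half-space where coordinate \<open>l0\<close> is at most
  \<open>real n powr 4\<close> meets the image only in parameters with
  \<open>v l0 \<le> real n\<close>, hence has mass at most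
  \<open>ennreal (real n - 1)\<close>.\<close>

lemma sigma_finite_D: "sigma_finite_measure \<mu>\<^sub>D"
proof -
  let ?X = "\<lambda>n::nat. {x :: real ^ 'n. x $ l0 \<le> real n powr 4}"
  have X [measurable]: "?X n \<in> sets borel" for n
    by measurable
  have "emeasure \<mu>\<^sub>D (?X n) \<noteq> \<infinity>" for n
  proof -
    define G where "G i t = (if i = l0 then indicator {..real n} t else 1 :: ennreal)" for i and t :: real
    have "emeasure \<mu>\<^sub>D (?X n) = (\<integral>\<^sup>+x. indicator (?X n) x \<partial>\<mu>\<^sub>D)"
      using X by (simp add: nn_integral_indicator)
    also have "\<dots> = (\<integral>\<^sup>+v. indicator {v. \<forall>i. v i \<in> tail_box i} v * indicator (?X n) (\<phi>\<^sub>D v) \<partial>coords)"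
      unfolding \<mu>\<^sub>D_def by (rule nn_integral_box_image) measurable
    also have "\<dots> \<le> (\<integral>\<^sup>+v. indicator {v. \<forall>i. v i \<in> tail_box i} v * (\<Prod>i\<in>UNIV. G i (v i)) \<partial>coords)"
    proof (rule nn_integral_mono)
      fix v :: "'n \<Rightarrow> real"
      have "v l0 \<le> real n" if "v l0 > 1" "v l0 powr 4 \<le> real n powr 4"
        using that powr_less_mono2[of 4 "real n" "v l0"] by (auto simp: not_le[symmetric])
      then have "indicator (?X n) (\<phi>\<^sub>D v) \<le> G l0 (v l0)" if "v l0 > 1"
        using that by (auto simp: G_def \<phi>\<^sub>D_def indicator_def)
      moreover have "v l0 > 1" if "\<forall>i. v i \<in> tail_box i"
        using that[rule_format, of l0] by (simp add: tail_box_def)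
      moreover have "(\<Prod>i\<in>UNIV. G i (v i)) = G l0 (v l0)"
        by (rule prod_eq_single) (simp add: G_def)
      ultimately show "indicator {v. \<forall>i. v i \<in> tail_box i} v * indicator (?X n) (\<phi>\<^sub>D v)
          \<le> indicator {v. \<forall>i. v i \<in> tail_box i} v * (\<Prod>i\<in>UNIV. G i (v i))"
        by (auto simp: indicator_def)
    qed
    also have "\<dots> = (\<Prod>i\<in>UNIV. \<integral>\<^sup>+t. indicator (tail_box i) t * G i t \<partial>lborel)"
      by (rule nn_integral_prod_box) (simp_all add: G_def)
    also have "\<dots> = ennreal (real n - 1)"
      by (subst prod_eq_single[of l0]) (simp_all add: G_def tail_box_def nn_integral_indicator_tail)
    finally show ?thesis by (auto simp: top_unique)
  qed
  moreover have "\<exists>n. x \<in> ?X n" for x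
  proof -
    obtain n :: nat where n: "max 1 (x $ l0) \<le> real n" using real_arch_simple by blast
    then have "real n powr 1 \<le> real n powr 4" by (intro powr_mono) auto
    moreover have "real n powr 1 = real n" by simp
    ultimately have "x $ l0 \<le> real n powr 4" using n by linarith
    then show ?thesis by blast
  qed
  ultimately show ?thesis
    unfolding sigma_finite_measure_def
    by (intro exI[of _ "range ?X"]) (use X sets_eq_imp_space_eq[of \<mu>\<^sub>D borel] in auto)
qed

lemma sigma_finite_\<mu>: "sigma_finite_measure \<mu>"
  unfolding \<mu>_def by (intro sigma_finite_add_measure sigma_finite_AB sigma_finite_D) simp_all

text \<open>Of the nine ordered pairs of pieces, those differing by order are merged by symmetry,
  which leaves six terms.\<close>

lemma pair_integral_\<mu>:
  assumes [measurable]: "case_prod f \<in> borel_measurable (borel \<Otimes>\<^sub>M borel)"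
    and sym: "\<And>x y. f x y = f y x"
  shows "pair_integral \<mu> \<mu> f = pair_integral \<mu>\<^sub>A \<mu>\<^sub>A f + 2 * pair_integral \<mu>\<^sub>A \<mu>\<^sub>B f + pair_integral \<mu>\<^sub>B \<mu>\<^sub>B f
     + 2 * (pair_integral \<mu>\<^sub>D \<mu>\<^sub>A f + pair_integral \<mu>\<^sub>D \<mu>\<^sub>B f) + pair_integral \<mu>\<^sub>D \<mu>\<^sub>D f"
proof -
  interpret D: sigma_finite_measure \<mu>\<^sub>D by (rule sigma_finite_D)
  have [measurable]: "case_prod f \<in> borel_measurable (M \<Otimes>\<^sub>M N)"
    if "sets M = sets borel" "sets N = sets borel" for M N
    using assms(1) by (subst measurable_cong_sets[OF sets_pair_measure_cong[OF that] refl])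
  have DA: "pair_integral \<mu>\<^sub>A \<mu>\<^sub>D f = pair_integral \<mu>\<^sub>D \<mu>\<^sub>A f"
    unfolding \<mu>\<^sub>A_def \<mu>\<^sub>D_def by (rule pair_integral_swap_box_image) (auto intro: sym)
  have DB: "pair_integral \<mu>\<^sub>B \<mu>\<^sub>D f = pair_integral \<mu>\<^sub>D \<mu>\<^sub>B f"
    unfolding \<mu>\<^sub>B_def \<mu>\<^sub>D_def by (rule pair_integral_swap_box_image) (auto intro: sym)
  have BA: "pair_integral \<mu>\<^sub>B \<mu>\<^sub>A f = pair_integral \<mu>\<^sub>A \<mu>\<^sub>B f"
    unfolding \<mu>\<^sub>B_def \<mu>\<^sub>A_def by (rule pair_integral_swap_box_image) (auto intro: sym)
  have l: "pair_integral (add_measure \<mu>\<^sub>A \<mu>\<^sub>B) \<mu>\<^sub>D f = pair_integral \<mu>\<^sub>D \<mu>\<^sub>A f + pair_integral \<mu>\<^sub>D \<mu>\<^sub>B f"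
    unfolding DA[symmetric] DB[symmetric] unfolding pair_integral_def
    by (rule nn_integral_add_measure) simp_all
  have r: "pair_integral \<mu>\<^sub>D (add_measure \<mu>\<^sub>A \<mu>\<^sub>B) f = pair_integral \<mu>\<^sub>D \<mu>\<^sub>A f + pair_integral \<mu>\<^sub>D \<mu>\<^sub>B f"
  proof -
    interpret A: sigma_finite_measure \<mu>\<^sub>A by (rule sigma_finite_AB)
    interpret B: sigma_finite_measure \<mu>\<^sub>B by (rule sigma_finite_AB)
    have "pair_integral \<mu>\<^sub>D (add_measure \<mu>\<^sub>A \<mu>\<^sub>B) f = (\<integral>\<^sup>+x. (\<integral>\<^sup>+y. f x y \<partial>\<mu>\<^sub>A) + (\<integral>\<^sup>+y. f x y \<partial>\<mu>\<^sub>B) \<partial>\<mu>\<^sub>D)"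
      unfolding pair_integral_def
      by (intro nn_integral_cong nn_integral_add_measure) simp_all
    then show ?thesis
      unfolding pair_integral_def by (subst (asm) nn_integral_add) simp_all
  qed
  show ?thesis
    unfolding \<mu>_def
    by (subst pair_integral_add_measure)
       (simp_all add: sigma_finite_add_measure sigma_finite_AB sigma_finite_D l r
         pair_integral_add_measure BA)
qed

section \<open>Inner products between the pieces\<close>

lemma inner_AA:
  assumes "\<And>i. v i \<in> {0<..<1}" "\<And>i. w i \<in> {0<..<1}"
  shows "16 \<le> \<phi>\<^sub>A v \<bullet> \<phi>\<^sub>A w"
proof -
  have "v i > 0" "w i > 0" for i using assms by auto
  then have "\<phi>\<^sub>A v $ e * \<phi>\<^sub>A w $ e \<le> \<phi>\<^sub>A v \<bullet> \<phi>\<^sub>A w"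
    unfolding inner_vec_def inner_real_def by (intro member_le_sum) (auto simp: \<phi>\<^sub>A_def less_imp_le intro!: mult_nonneg_nonneg)
  moreover have "4 * 4 \<le> \<phi>\<^sub>A v $ e * \<phi>\<^sub>A w $ e"
    by (intro mult_mono) (simp_all add: \<phi>\<^sub>A_def)
  ultimately show ?thesis by simp
qed

text \<open>Coordinate \<open>e\<close> contributes at most 1/4. Each of the other
  \<open>d - 1\<close> coordinates lies between 0 and \<open>1 / d\<close>, so together they
  contribute at most \<open>(d - 1) / d^2\<close>, again at most 1/4.\<close>

lemma inner_BB:
  assumes "\<And>i. v i \<in> {0<..<1}" "\<And>i. w i \<in> {0<..<1}"
  shows "\<phi>\<^sub>B v \<bullet> \<phi>\<^sub>B w < 1"
proof -
  have v: "0 < v i" "v i < 1" "0 < w i" "w i < 1" for i using assms[of i] by auto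
  then have p: "v i powr (1 / \<beta>) < 1" "w i powr (1 / \<beta>) < 1" for i
    using \<beta> powr_less_mono2[of "1 / \<beta>" "v i" 1] powr_less_mono2[of "1 / \<beta>" "w i" 1]
    by (simp_all add: less_imp_le)
  have "\<phi>\<^sub>B v \<bullet> \<phi>\<^sub>B w = \<phi>\<^sub>B v $ e * \<phi>\<^sub>B w $ e + (\<Sum>i\<in>-{e}. \<phi>\<^sub>B v $ i * \<phi>\<^sub>B w $ i)"
    unfolding inner_vec_def inner_real_def by (subst sum.remove[of UNIV e]) (simp_all add: Compl_eq_Diff_UNIV)
  also have "\<phi>\<^sub>B v $ e * \<phi>\<^sub>B w $ e \<le> (1 / 2) * (1 / 2)"
    using p[of e] by (intro mult_mono) (auto simp: \<phi>\<^sub>B_def)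
  also have "(\<Sum>i\<in>-{e}. \<phi>\<^sub>B v $ i * \<phi>\<^sub>B w $ i) \<le> (\<Sum>i\<in>-{e}. (1 / d) * (1 / d))"
  proof (intro sum_mono mult_mono)
    fix i assume "i \<in> - {e}"
    then show "\<phi>\<^sub>B v $ i \<le> 1 / d" "\<phi>\<^sub>B w $ i \<le> 1 / d" "0 \<le> 1 / d" "0 \<le> \<phi>\<^sub>B w $ i"
      using v[of i] p[of i] d_gt_1 by (auto simp: \<phi>\<^sub>B_def divide_right_mono)
  qed
  also have "(\<Sum>i\<in>-{e}. (1 / d) * (1 / d)) = (d - 1) * (1 / d * (1 / d))"
    using d_gt_1 d by (simp add: Compl_eq_Diff_UNIV of_nat_diff)
  also have "\<dots> \<le> 1 / 4"
  proof -
    \<comment> \<open>Expanded, this is \<open>4 * (d - 1) \<le> d^2\<close>.\<close>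
    have "0 \<le> (d - 2)\<^sup>2" by simp
    then show ?thesis using d_gt_1 by (simp add: field_simps power2_eq_square)
  qed
  finally show ?thesis by simp
qed

text \<open>The supports share only \<open>e\<close>, where the factors 4 and 1/4 cancel, and
  \<open>k0\<close>, because \<open>K\<close> and \<open>L\<close> are disjoint.\<close>

lemma inner_AB:
  "\<phi>\<^sub>A v \<bullet> \<phi>\<^sub>B w = (1 + v e powr (1 / \<alpha>)) * (1 + w e powr (1 / \<beta>)) + v k0 * w k0 powr (1 / \<beta>) / d"
proof -
  have "\<phi>\<^sub>A v \<bullet> \<phi>\<^sub>B w = (\<Sum>i\<in>{e, k0}. \<phi>\<^sub>A v $ i * \<phi>\<^sub>B w $ i)"
    unfolding inner_vec_def inner_real_def using KL(2)
    by (intro sum.mono_neutral_cong_right) (auto simp: \<phi>\<^sub>A_def \<phi>\<^sub>B_def)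
  then show ?thesis by (simp add: \<phi>\<^sub>A_def \<phi>\<^sub>B_def)
qed

lemma inner_D_ge:
  assumes "\<And>i. v i \<in> tail_box i" "\<And>i. 0 \<le> y $ i" "1 / 4 \<le> y $ e"
  shows "2 * v l0 powr (1 / \<gamma>) \<le> \<phi>\<^sub>D v \<bullet> y"
proof -
  have v: "v i > 0" for i using assms(1)[of i] by (auto simp: tail_box_def split: if_splits)
  then have "\<phi>\<^sub>D v $ e * y $ e \<le> \<phi>\<^sub>D v \<bullet> y"
    unfolding inner_vec_def inner_real_def using assms(2)
    by (intro member_le_sum) (auto simp: \<phi>\<^sub>D_def less_imp_le intro!: mult_nonneg_nonneg)
  moreover have "(8 * v l0 powr (1 / \<gamma>)) * (1 / 4) \<le> \<phi>\<^sub>D v $ e * y $ e"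
    using assms by (intro mult_mono) (simp_all add: \<phi>\<^sub>D_def)
  ultimately show ?thesis by simp
qed

text \<open>Coordinate \<open>e\<close> contributes at least 1, which cancels the 1 in the upper end
  \<open>1 + \<epsilon>\<close> of the strip; the remaining term comes from
  \<open>l0\<close>.\<close>

lemma inner_DD:
  assumes "\<And>i. v i \<in> tail_box i" "\<And>i. w i \<in> tail_box i"
  shows "1 + v l0 powr 4 * w l0 powr 4 \<le> \<phi>\<^sub>D v \<bullet> \<phi>\<^sub>D w"
proof -
  have v: "v i > 0" "w i > 0" for i
    using assms[of i] by (auto simp: tail_box_def split: if_splits)
  have v1: "v l0 > 1" "w l0 > 1" using assms[of l0] by (simp_all add: tail_box_def)
  have "(\<Sum>i\<in>{e, l0}. \<phi>\<^sub>D v $ i * \<phi>\<^sub>D w $ i) \<le> \<phi>\<^sub>D v \<bullet> \<phi>\<^sub>D w"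
    unfolding inner_vec_def inner_real_def using v
    by (intro sum_mono2) (auto simp: \<phi>\<^sub>D_def less_imp_le intro!: mult_nonneg_nonneg)
  moreover have "1 * 1 \<le> (8 * v l0 powr (1 / \<gamma>)) * (8 * w l0 powr (1 / \<gamma>))"
    using v1 \<gamma> ge_one_powr_ge_zero[of "v l0" "1 / \<gamma>"] ge_one_powr_ge_zero[of "w l0" "1 / \<gamma>"]
    by (intro mult_mono) auto
  ultimately show ?thesis by (simp add: \<phi>\<^sub>D_def)
qed

text \<open>The first piece vanishes in \<open>l0\<close>, so the fast growth there is not seen.
  Coordinate \<open>e\<close> gives at most \<open>8 * 8\<close> times the power of
  \<open>v l0\<close>, every other coordinate at most 1, and these are absorbed since that power is
  at least 1.\<close>

lemma inner_DA_le:
  assumes "\<And>i. v i \<in> tail_box i" "\<And>i. w i \<in> {0<..<1}"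
  shows "\<phi>\<^sub>D v \<bullet> \<phi>\<^sub>A w \<le> (64 + d) * v l0 powr (1 / \<gamma>)"
proof -
  let ?V = "v l0 powr (1 / \<gamma>)"
  have v: "v i > 0" "w i > 0" "w i < 1" for i
    using assms[of i] by (auto simp: tail_box_def split: if_splits)
  have V: "1 \<le> ?V" using assms(1)[of l0] \<gamma> by (auto simp: tail_box_def intro!: ge_one_powr_ge_zero)
  have w: "w e powr (1 / \<alpha>) \<le> 1"
    using v[of e] \<alpha> powr_mono2[of "1 / \<alpha>" "w e" 1] by simp
  have "\<phi>\<^sub>D v \<bullet> \<phi>\<^sub>A w = \<phi>\<^sub>D v $ e * \<phi>\<^sub>A w $ e + (\<Sum>i\<in>-{e}. \<phi>\<^sub>D v $ i * \<phi>\<^sub>A w $ i)"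
    unfolding inner_vec_def inner_real_def by (subst sum.remove[of UNIV e]) (simp_all add: Compl_eq_Diff_UNIV)
  also have "\<phi>\<^sub>D v $ e * \<phi>\<^sub>A w $ e \<le> (8 * ?V) * 8"
    using w by (intro mult_mono) (auto simp: \<phi>\<^sub>D_def \<phi>\<^sub>A_def)
  also have "(\<Sum>i\<in>-{e}. \<phi>\<^sub>D v $ i * \<phi>\<^sub>A w $ i) \<le> (\<Sum>i\<in>-{e}. 1)"
  proof (intro sum_mono)
    fix i assume i: "i \<in> - {e}"
    have "v i * w i \<le> 1 * 1" if "i \<in> K"
    proof (rule mult_mono)
      have "i \<noteq> l0" using that by auto
      then show "v i \<le> 1" using assms(1)[of i] by (simp add: tail_box_def)
    qed (use v[of i] in auto)
    moreover have "i \<noteq> l0" if "i \<in> K" using that by auto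
    ultimately show "\<phi>\<^sub>D v $ i * \<phi>\<^sub>A w $ i \<le> 1"
      using i by (auto simp: \<phi>\<^sub>D_def \<phi>\<^sub>A_def)
  qed
  also have "(\<Sum>i\<in>-{e}. 1) \<le> d * ?V"
  proof -
    have "(\<Sum>i\<in>-{e}. 1) \<le> d" using card_mono[of UNIV "-{e}"] d by simp
    also have "\<dots> = d * 1" by simp
    also have "\<dots> \<le> d * ?V" using V d by (intro mult_left_mono) auto
    finally show ?thesis .
  qed
  finally show ?thesis by (simp add: algebra_simps)
qed

lemma bounds_A:
  assumes "\<And>i. v i \<in> {0<..<1}"
  shows "0 \<le> \<phi>\<^sub>A v $ i" "\<phi>\<^sub>A v $ i \<le> 8" "4 \<le> \<phi>\<^sub>A v $ e" "\<phi>\<^sub>A v $ l0 = 0"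
proof -
  have v: "0 < v i" "v i < 1" for i using assms[of i] by auto
  have "v i powr (1 / \<alpha>) \<le> 1" for i
    using v[of i] \<alpha> powr_mono2[of "1 / \<alpha>" "v i" 1] by simp
  then show "0 \<le> \<phi>\<^sub>A v $ i" "\<phi>\<^sub>A v $ i \<le> 8" "4 \<le> \<phi>\<^sub>A v $ e" "\<phi>\<^sub>A v $ l0 = 0"
    using v[of i] by (auto simp: \<phi>\<^sub>A_def)
qed

lemma bounds_B:
  assumes "\<And>i. v i \<in> {0<..<1}"
  shows "0 \<le> \<phi>\<^sub>B v $ i" "\<phi>\<^sub>B v $ i \<le> 1" "1 / 4 \<le> \<phi>\<^sub>B v $ e"
proof -
  have v: "0 < v i" "v i < 1" for i using assms[of i] by auto
  have p: "v i powr (1 / \<beta>) \<le> 1" for i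
    using v[of i] \<beta> powr_mono2[of "1 / \<beta>" "v i" 1] by simp
  have "v i \<le> d" "v i powr (1 / \<beta>) \<le> d" "v e powr (1 / \<beta>) \<le> 3"
    using v[of i] p[of i] p[of e] d_gt_1 by linarith+
  then show "0 \<le> \<phi>\<^sub>B v $ i" "\<phi>\<^sub>B v $ i \<le> 1" "1 / 4 \<le> \<phi>\<^sub>B v $ e"
    using v[of i] d_gt_1 by (auto simp: \<phi>\<^sub>B_def less_imp_le add_nonneg_nonneg)
qed

subsection \<open>Measures of the strips\<close>

text \<open>Inner products of at least 16 enter the strip only if
  \<open>\<epsilon> \<ge> 15\<close>, and then the right-hand side exceeds the total mass 1.\<close>

lemma strip_AA_le:
  assumes "\<epsilon> > 0"
  shows "pair_integral \<mu>\<^sub>A \<mu>\<^sub>A (strip_indicator \<epsilon>) \<le> ennreal (\<epsilon> powr \<gamma>)"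
  unfolding \<mu>\<^sub>A_def
proof (rule pair_integral_unit_box_le)
  fix v w :: "'n \<Rightarrow> real"
  assume "\<And>i. v i \<in> {0<..<1}" "\<And>i. w i \<in> {0<..<1}"
  then have "16 \<le> \<phi>\<^sub>A v \<bullet> \<phi>\<^sub>A w" by (rule inner_AA)
  then show "strip_indicator \<epsilon> (\<phi>\<^sub>A v) (\<phi>\<^sub>A w) \<le> ennreal (\<epsilon> powr \<gamma>)"
    using \<gamma> by (intro strip_indicator_leI) (auto intro!: ge_one_powr_ge_zero)
qed measurable

lemma strip_BB: "pair_integral \<mu>\<^sub>B \<mu>\<^sub>B (strip_indicator \<epsilon>) = 0"
proof -
  have "pair_integral \<mu>\<^sub>B \<mu>\<^sub>B (strip_indicator \<epsilon>) \<le> 0"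
    unfolding \<mu>\<^sub>B_def
  proof (rule pair_integral_unit_box_le)
    fix v w :: "'n \<Rightarrow> real"
    assume "\<And>i. v i \<in> {0<..<1}" "\<And>i. w i \<in> {0<..<1}"
    then have "\<phi>\<^sub>B v \<bullet> \<phi>\<^sub>B w < 1" by (rule inner_BB)
    then show "strip_indicator \<epsilon> (\<phi>\<^sub>B v) (\<phi>\<^sub>B w) \<le> 0"
      by (intro strip_indicator_leI) auto
  qed measurable
  then show ?thesis by simp
qed

lemma powr_inverse_le_iff:
  fixes t x p :: real
  assumes "0 < t" "0 < x" "0 < p"
  shows "t powr (1 / p) \<le> x \<longleftrightarrow> t \<le> x powr p"
  using assms powr_mono2[of p "t powr (1 / p)" x] powr_mono2[of "1 / p" t "x powr p"]
  by (auto simp: powr_powr)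

text \<open>In the strip every nonnegative term of \<open>inner_AB\<close> beyond 1 is at most
  \<open>\<epsilon>\<close>. This forces \<open>v e \<le> \<epsilon> powr \<alpha>\<close> and
  \<open>w e \<le> \<epsilon> powr \<beta>\<close>, and bounds \<open>w k0\<close> by
  \<open>(d * \<epsilon> / v k0) powr \<beta>\<close>. The three exponents add up to
  \<open>\<alpha> + 2 * \<beta> = \<gamma>\<close>.\<close>

lemma strip_AB_le:
  assumes \<epsilon>: "\<epsilon> > 0"
  shows "pair_integral \<mu>\<^sub>A \<mu>\<^sub>B (strip_indicator \<epsilon>) \<le> ennreal (2 * d * \<epsilon> powr \<gamma>)"
proof -
  define G :: "'n \<Rightarrow> real \<Rightarrow> real \<Rightarrow> ennreal" where
    "G i t u = (if i = e then indicator {..\<epsilon> powr \<alpha>} t * indicator {..\<epsilon> powr \<beta>} u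
       else if i = k0 then (if u \<le> (d * \<epsilon>) powr \<beta> * t powr (- \<beta>) then 1 else 0) else 1)" for i t u
  have mG [measurable]: "case_prod (G i) \<in> borel_measurable (borel \<Otimes>\<^sub>M borel)" for i
  proof -
    consider "i = e" | "i = k0" | "i \<noteq> e" "i \<noteq> k0" by blast
    then show ?thesis
    proof cases
      case 2
      have "case_prod (G k0) = (\<lambda>p. if snd p \<le> (d * \<epsilon>) powr \<beta> * fst p powr (- \<beta>) then 1 else 0)"
        by (simp only: G_def split_beta' distinct if_False simp_thms if_True)
      then show ?thesis unfolding 2 by (simp only: measurable_indicator_below_powr)
    qed (simp_all add: G_def split_beta')
  qed
  have prod_G: "(\<Prod>i\<in>UNIV. G i (v i) (w i)) = G e (v e) (w e) * G k0 (v k0) (w k0)" for v w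
    by (rule prod_eq_pair) (auto simp: G_def)
  have "pair_integral \<mu>\<^sub>A \<mu>\<^sub>B (strip_indicator \<epsilon>) \<le>
     (\<Prod>i\<in>UNIV. \<integral>\<^sup>+t. indicator (unit_box i) t *
        (\<integral>\<^sup>+u. indicator (unit_box i) u * G i t u \<partial>lborel) \<partial>lborel)"
    unfolding \<mu>\<^sub>A_def \<mu>\<^sub>B_def
  proof (rule pair_integral_box_image_le)
    fix v w :: "'n \<Rightarrow> real"
    assume vw: "\<And>i. v i \<in> unit_box i" "\<And>i. w i \<in> unit_box i"
    then have pos: "0 < v i" "0 < w i" for i by (simp_all add: unit_box_def)
    let ?t = "v e powr (1 / \<alpha>)" and ?u = "w e powr (1 / \<beta>)" and ?x = "v k0 * w k0 powr (1 / \<beta>) / d"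
    show "strip_indicator \<epsilon> (\<phi>\<^sub>A v) (\<phi>\<^sub>B w) \<le> (\<Prod>i\<in>UNIV. G i (v i) (w i))"
    proof (rule strip_indicator_leI)
      assume "\<phi>\<^sub>A v \<bullet> \<phi>\<^sub>B w \<le> 1 + \<epsilon>"
      then have le: "(1 + ?t) * (1 + ?u) + ?x \<le> 1 + \<epsilon>" by (simp add: inner_AB)
      have nn: "0 \<le> ?t" "0 \<le> ?u" "0 \<le> ?t * ?u" by simp_all
      have x: "0 \<le> ?x" using pos[of k0] d_gt_1 by simp
      have "(1 + ?t) * (1 + ?u) = 1 + ?t + ?u + ?t * ?u" by (simp add: algebra_simps)
      with le nn x have "?t \<le> \<epsilon>" "?u \<le> \<epsilon>" "?x \<le> \<epsilon>" by linarith+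
      then have "v e \<le> \<epsilon> powr \<alpha>" "w e \<le> \<epsilon> powr \<beta>"
        using pos \<epsilon> \<alpha> \<beta> by (intro iffD1[OF powr_inverse_le_iff]; simp)+
      moreover have "w k0 powr (1 / \<beta>) \<le> d * \<epsilon> / v k0"
        using \<open>?x \<le> \<epsilon>\<close> pos[of k0] d_gt_1 by (simp add: field_simps)
      moreover from this have "w k0 \<le> (d * \<epsilon> / v k0) powr \<beta>"
        using pos \<epsilon> \<beta> d_gt_1 by (subst (asm) powr_inverse_le_iff) auto
      moreover have "(d * \<epsilon> / v k0) powr \<beta> = (d * \<epsilon>) powr \<beta> * v k0 powr (- \<beta>)"
        using pos[of k0] \<epsilon> d_gt_1 by (simp add: powr_divide powr_minus_divide)
      ultimately show "1 \<le> (\<Prod>i\<in>UNIV. G i (v i) (w i))"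
        by (simp add: prod_G) (simp add: G_def)
    qed
  qed measurable
  also have "\<dots> = (\<integral>\<^sup>+t. indicator {0<..<1} t * (\<integral>\<^sup>+u. indicator {0<..<1} u * G e t u \<partial>lborel) \<partial>lborel) *
      (\<integral>\<^sup>+t. indicator {0<..<1} t * (\<integral>\<^sup>+u. indicator {0<..<1} u * G k0 t u \<partial>lborel) \<partial>lborel)"
    unfolding unit_box_def
    by (rule prod_eq_pair) (auto simp: G_def)
  also have "\<dots> \<le> ennreal (\<epsilon> powr \<alpha> * \<epsilon> powr \<beta>) * ennreal ((d * \<epsilon>) powr \<beta> / (1 - \<beta>))"
  proof (rule mult_mono)
    have "(\<integral>\<^sup>+t. indicator {0<..<1} t * (\<integral>\<^sup>+u. indicator {0<..<1} u * G e t u \<partial>lborel) \<partial>lborel)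
       = (\<integral>\<^sup>+t. indicator {0<..<1} t * indicator {..\<epsilon> powr \<alpha>} t *
            (\<integral>\<^sup>+u. indicator {0<..<1} u * indicator {..\<epsilon> powr \<beta>} u \<partial>lborel) \<partial>lborel)"
      by (subst nn_integral_cmult[symmetric]) (simp_all add: G_def mult_ac nn_integral_cmult)
    also have "\<dots> = (\<integral>\<^sup>+t. indicator {0<..<1} t * indicator {..\<epsilon> powr \<alpha>} t \<partial>lborel) *
            (\<integral>\<^sup>+u. indicator {0<..<1} u * indicator {..\<epsilon> powr \<beta>} u \<partial>lborel)"
      by (rule nn_integral_multc) simp
    also have "\<dots> \<le> ennreal (\<epsilon> powr \<alpha>) * ennreal (\<epsilon> powr \<beta>)"
      by (intro mult_mono nn_integral_indicator_initial_le) simp_all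
    finally show "(\<integral>\<^sup>+t. indicator {0<..<1} t * (\<integral>\<^sup>+u. indicator {0<..<1} u * G e t u \<partial>lborel) \<partial>lborel)
       \<le> ennreal (\<epsilon> powr \<alpha> * \<epsilon> powr \<beta>)"
      by (simp add: ennreal_mult)
  next
    \<comment> \<open>The admissible \<open>u\<close> have length at most
      \<open>(d * \<epsilon>) powr \<beta> * t powr (- \<beta>)\<close>, and the singularity at
      \<open>t = 0\<close> is integrable because \<open>\<beta> < 1\<close>.\<close>
    have "(\<integral>\<^sup>+t. indicator {0<..<1} t * (\<integral>\<^sup>+u. indicator {0<..<1} u * G k0 t u \<partial>lborel) \<partial>lborel)
       \<le> (\<integral>\<^sup>+t. ennreal ((d * \<epsilon>) powr \<beta>) * (indicator {0<..<1} t * ennreal (t powr (- \<beta>))) \<partial>lborel)"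
    proof (rule nn_integral_mono)
      fix t :: real
      have "(\<integral>\<^sup>+u. indicator {0<..<1} u * G k0 t u \<partial>lborel)
          = (\<integral>\<^sup>+u. indicator {0<..<1} u * indicator {..(d * \<epsilon>) powr \<beta> * t powr (- \<beta>)} u \<partial>lborel)"
        by (intro nn_integral_cong) (simp add: G_def indicator_def)
      also have "\<dots> \<le> ennreal ((d * \<epsilon>) powr \<beta> * t powr (- \<beta>))"
        by (intro nn_integral_indicator_initial_le) simp
      finally show "indicator {0<..<1} t * (\<integral>\<^sup>+u. indicator {0<..<1} u * G k0 t u \<partial>lborel)
         \<le> ennreal ((d * \<epsilon>) powr \<beta>) * (indicator {0<..<1} t * ennreal (t powr (- \<beta>)))"
        by (auto simp: indicator_def ennreal_mult)
    qed
    also have "\<dots> = ennreal ((d * \<epsilon>) powr \<beta>) * ennreal (1 / (1 - \<beta>))"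
      using nn_integral_powr_from_0[of "- \<beta>" 1] \<beta> by (simp add: nn_integral_cmult)
    finally show "(\<integral>\<^sup>+t. indicator {0<..<1} t * (\<integral>\<^sup>+u. indicator {0<..<1} u * G k0 t u \<partial>lborel) \<partial>lborel)
       \<le> ennreal ((d * \<epsilon>) powr \<beta> / (1 - \<beta>))"
      using \<beta> by (simp add: ennreal_mult[symmetric])
  qed simp_all
  also have "\<dots> = ennreal (\<epsilon> powr \<alpha> * \<epsilon> powr \<beta> * ((d * \<epsilon>) powr \<beta> / (1 - \<beta>)))"
    using \<beta> by (intro ennreal_mult[symmetric]) auto
  also have "\<epsilon> powr \<alpha> * \<epsilon> powr \<beta> * ((d * \<epsilon>) powr \<beta> / (1 - \<beta>)) = (d powr \<beta> / (1 - \<beta>)) * \<epsilon> powr \<gamma>"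
  proof -
    have "\<epsilon> powr \<gamma> = \<epsilon> powr \<alpha> * \<epsilon> powr \<beta> * \<epsilon> powr \<beta>"
      by (simp add: powr_add[symmetric] add.commute flip: \<alpha>\<beta>)
    moreover have "(d * \<epsilon>) powr \<beta> = d powr \<beta> * \<epsilon> powr \<beta>"
      using \<epsilon> d_gt_1 by (simp add: powr_mult)
    ultimately show ?thesis by simp
  qed
  also have "\<dots> \<le> 2 * d * \<epsilon> powr \<gamma>"
  proof (rule mult_right_mono)
    have "d powr \<beta> \<le> d powr 1" using \<beta> d_gt_1 by (intro powr_mono) auto
    then have "d powr \<beta> / (1 - \<beta>) \<le> d / (1 / 2)" using \<beta> d_gt_1 by (intro frac_le) auto
    then show "d powr \<beta> / (1 - \<beta>) \<le> 2 * d" by simp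
  qed simp
  finally show ?thesis by (simp add: ennreal_leI)
qed

text \<open>Applied to the first and the second piece alike: the inner product is at least twice the
  power of \<open>v l0\<close> by \<open>inner_D_ge\<close>, which in the strip restricts
  \<open>v l0\<close> to an interval of length at most
  \<open>\<epsilon> powr \<gamma>\<close>.\<close>

lemma strip_D_le:
  fixes \<psi> :: "('n \<Rightarrow> real) \<Rightarrow> real ^ 'n"
  assumes \<epsilon>: "\<epsilon> > 0" and [measurable]: "\<psi> \<in> measurable coords borel"
    and \<psi>: "\<And>w i. (\<And>i. w i \<in> {0<..<1}) \<Longrightarrow> 0 \<le> \<psi> w $ i" "\<And>w. (\<And>i. w i \<in> {0<..<1}) \<Longrightarrow> 1 / 4 \<le> \<psi> w $ e"
  shows "pair_integral \<mu>\<^sub>D (box_image unit_box \<psi>) (strip_indicator \<epsilon>) \<le> ennreal (\<epsilon> powr \<gamma>)"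
proof -
  define G :: "'n \<Rightarrow> real \<Rightarrow> real \<Rightarrow> ennreal" where
    "G i t u = (if i = l0 then indicator {..\<epsilon> powr \<gamma>} t else 1)" for i t u
  have mG [measurable]: "case_prod (G i) \<in> borel_measurable (borel \<Otimes>\<^sub>M borel)" for i
    unfolding G_def split_beta' by (cases "i = l0"; simp)
  have "pair_integral \<mu>\<^sub>D (box_image unit_box \<psi>) (strip_indicator \<epsilon>) \<le>
     (\<Prod>i\<in>UNIV. \<integral>\<^sup>+t. indicator (tail_box i) t *
        (\<integral>\<^sup>+u. indicator (unit_box i) u * G i t u \<partial>lborel) \<partial>lborel)"
    unfolding \<mu>\<^sub>D_def
  proof (rule pair_integral_box_image_le)
    fix v w :: "'n \<Rightarrow> real"
    assume v: "\<And>i. v i \<in> tail_box i" and w: "\<And>i. w i \<in> unit_box i"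
    let ?V = "v l0 powr (1 / \<gamma>)"
    have v1: "1 < v l0" using v[of l0] by (simp add: tail_box_def)
    have V: "1 \<le> ?V" using v1 \<gamma> by (intro ge_one_powr_ge_zero) auto
    have "2 * ?V \<le> \<phi>\<^sub>D v \<bullet> \<psi> w"
      using w by (intro inner_D_ge v \<psi>) (simp_all add: unit_box_def)
    moreover have "(\<Prod>i\<in>UNIV. G i (v i) (w i)) = G l0 (v l0) (w l0)"
      by (rule prod_eq_single) (simp add: G_def)
    \<comment> \<open>Subtracting \<open>1 \<le> ?V\<close> from
      \<open>2 * ?V \<le> 1 + \<epsilon>\<close> leaves \<open>?V \<le> \<epsilon>\<close>.\<close>
    moreover have "v l0 \<le> \<epsilon> powr \<gamma>" if "2 * ?V \<le> 1 + \<epsilon>"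
      using that V v1 \<epsilon> \<gamma> powr_inverse_le_iff[of "v l0" \<epsilon> \<gamma>] by simp
    ultimately show "strip_indicator \<epsilon> (\<phi>\<^sub>D v) (\<psi> w) \<le> (\<Prod>i\<in>UNIV. G i (v i) (w i))"
      by (intro strip_indicator_leI) (simp add: G_def)
  qed measurable
  also have "\<dots> = ennreal (\<epsilon> powr \<gamma> - 1)"
    by (subst prod_eq_single[of l0])
       (auto simp: G_def tail_box_def unit_box_def nn_integral_multc nn_integral_indicator_tail)
  finally show ?thesis by (rule order_trans) (simp add: ennreal_leI)
qed

text \<open>By \<open>inner_DD\<close> both fourth powers are at most \<open>\<epsilon>\<close>,
  which is then at least 1. Since \<open>1 / 4 \<le> \<gamma> / 2\<close>, both parameters are at
  most \<open>\<epsilon> powr (\<gamma> / 2)\<close>.\<close>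

lemma strip_DD_le:
  assumes \<epsilon>: "\<epsilon> > 0"
  shows "pair_integral \<mu>\<^sub>D \<mu>\<^sub>D (strip_indicator \<epsilon>) \<le> ennreal (\<epsilon> powr \<gamma>)"
proof -
  define G :: "'n \<Rightarrow> real \<Rightarrow> real \<Rightarrow> ennreal" where
    "G i t u = (if i = l0 then indicator {..\<epsilon> powr (\<gamma> / 2)} t * indicator {..\<epsilon> powr (\<gamma> / 2)} u else 1)" for i t u
  have mG [measurable]: "case_prod (G i) \<in> borel_measurable (borel \<Otimes>\<^sub>M borel)" for i
    unfolding G_def split_beta' by (cases "i = l0"; simp)
  have "pair_integral \<mu>\<^sub>D \<mu>\<^sub>D (strip_indicator \<epsilon>) \<le>
     (\<Prod>i\<in>UNIV. \<integral>\<^sup>+t. indicator (tail_box i) t *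
        (\<integral>\<^sup>+u. indicator (tail_box i) u * G i t u \<partial>lborel) \<partial>lborel)"
    unfolding \<mu>\<^sub>D_def
  proof (rule pair_integral_box_image_le)
    fix v w :: "'n \<Rightarrow> real"
    assume v: "\<And>i. v i \<in> tail_box i" and w: "\<And>i. w i \<in> tail_box i"
    have v1: "1 < v l0" "1 < w l0" using v[of l0] w[of l0] by (simp_all add: tail_box_def)
    have "strip_indicator \<epsilon> (\<phi>\<^sub>D v) (\<phi>\<^sub>D w) \<le> G l0 (v l0) (w l0)"
    proof (rule strip_indicator_leI)
      assume "\<phi>\<^sub>D v \<bullet> \<phi>\<^sub>D w \<le> 1 + \<epsilon>"
      with inner_DD[of v w] v w have le: "v l0 powr 4 * w l0 powr 4 \<le> \<epsilon>" by simp
      have ge: "1 \<le> v l0 powr 4" "1 \<le> w l0 powr 4" using v1 by (auto intro!: ge_one_powr_ge_zero)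
      have "v l0 powr 4 * 1 \<le> v l0 powr 4 * w l0 powr 4" "1 * w l0 powr 4 \<le> v l0 powr 4 * w l0 powr 4"
        using ge by (intro mult_mono; simp)+
      with le ge have \<epsilon>1: "1 \<le> \<epsilon>" "v l0 powr 4 \<le> \<epsilon>" "w l0 powr 4 \<le> \<epsilon>" by linarith+
      have "t \<le> \<epsilon> powr (\<gamma> / 2)" if "1 < t" "t powr 4 \<le> \<epsilon>" for t
      proof -
        have "t \<le> \<epsilon> powr (1 / 4)"
          using that \<epsilon> powr_inverse_le_iff[of t \<epsilon> "1 / 4"] by simp
        also have "\<dots> \<le> \<epsilon> powr (\<gamma> / 2)" using \<epsilon>1 \<gamma> by (intro powr_mono) auto
        finally show ?thesis .
      qed
      with \<epsilon>1 v1 show "1 \<le> G l0 (v l0) (w l0)" by (simp add: G_def)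
    qed
    moreover have "(\<Prod>i\<in>UNIV. G i (v i) (w i)) = G l0 (v l0) (w l0)"
      by (rule prod_eq_single) (simp add: G_def)
    ultimately show "strip_indicator \<epsilon> (\<phi>\<^sub>D v) (\<phi>\<^sub>D w) \<le> (\<Prod>i\<in>UNIV. G i (v i) (w i))"
      by simp
  qed measurable
  also have "\<dots> = (\<integral>\<^sup>+t. indicator {1<..} t *
        (\<integral>\<^sup>+u. indicator {1<..} u * G l0 t u \<partial>lborel) \<partial>lborel)"
    by (subst prod_eq_single[of l0]) (auto simp: G_def tail_box_def)
  also have "\<dots> = (\<integral>\<^sup>+t. indicator {1<..} t * indicator {..\<epsilon> powr (\<gamma> / 2)} t *
        (\<integral>\<^sup>+u. indicator {1<..} u * indicator {..\<epsilon> powr (\<gamma> / 2)} u \<partial>lborel) \<partial>lborel)"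
    by (subst nn_integral_cmult[symmetric]) (simp_all add: G_def mult_ac nn_integral_cmult)
  also have "\<dots> = ennreal (\<epsilon> powr (\<gamma> / 2) - 1) * ennreal (\<epsilon> powr (\<gamma> / 2) - 1)"
    by (subst nn_integral_multc) (simp_all add: nn_integral_indicator_tail)
  also have "\<dots> \<le> ennreal (\<epsilon> powr (\<gamma> / 2)) * ennreal (\<epsilon> powr (\<gamma> / 2))"
    by (intro mult_mono ennreal_leI) simp_all
  also have "\<dots> = ennreal (\<epsilon> powr \<gamma>)"
    by (simp add: ennreal_mult[symmetric] powr_add[symmetric])
  finally show ?thesis .
qed

text \<open>The four terms of \<open>inner_AB\<close> beyond 1 are each kept below
  \<open>\<epsilon> / 4\<close>. The bound \<open>\<epsilon> \<le> 1\<close> controls the mixed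
  product and keeps the parameter intervals inside the unit interval.\<close>

lemma strip_AB_ge:
  assumes \<epsilon>: "0 < \<epsilon>" "\<epsilon> \<le> 1"
  shows "ennreal ((\<epsilon> / 4) powr \<gamma>) \<le> pair_integral \<mu>\<^sub>A \<mu>\<^sub>B (strip_indicator \<epsilon>)"
proof -
  define G :: "'n \<Rightarrow> real \<Rightarrow> real \<Rightarrow> ennreal" where
    "G i t u = (if i = e then indicator {..(\<epsilon> / 4) powr \<alpha>} t * indicator {..(\<epsilon> / 4) powr \<beta>} u
       else if i = k0 then indicator {..(\<epsilon> / 4) powr \<beta>} u else 1)" for i t u
  have mG [measurable]: "case_prod (G i) \<in> borel_measurable (borel \<Otimes>\<^sub>M borel)" for i
    unfolding G_def split_beta' by (cases "i = e"; cases "i = k0"; simp)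
  have le1: "(\<epsilon> / 4) powr \<alpha> \<le> 1" "(\<epsilon> / 4) powr \<beta> \<le> 1"
    using \<epsilon> \<alpha> \<beta> by (auto intro!: powr_le1)
  have "(\<epsilon> / 4) powr \<gamma> = (\<epsilon> / 4) powr \<alpha> * (\<epsilon> / 4) powr \<beta> * (\<epsilon> / 4) powr \<beta>"
    by (simp add: powr_add[symmetric] add.commute flip: \<alpha>\<beta>)
  then have "ennreal ((\<epsilon> / 4) powr \<gamma>) =
      ennreal ((\<epsilon> / 4) powr \<alpha>) * ennreal ((\<epsilon> / 4) powr \<beta>) * ennreal ((\<epsilon> / 4) powr \<beta>)"
    by (simp add: ennreal_mult)
  also have "\<dots> = (\<integral>\<^sup>+t. indicator {0<..<1} t * (\<integral>\<^sup>+u. indicator {0<..<1} u * G e t u \<partial>lborel) \<partial>lborel) *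
      (\<integral>\<^sup>+t. indicator {0<..<1} t * (\<integral>\<^sup>+u. indicator {0<..<1} u * G k0 t u \<partial>lborel) \<partial>lborel)"
  proof -
    have "(\<integral>\<^sup>+t. indicator {0<..<1} t * (\<integral>\<^sup>+u. indicator {0<..<1} u * G e t u \<partial>lborel) \<partial>lborel)
       = (\<integral>\<^sup>+t. indicator {0<..<1} t * indicator {..(\<epsilon> / 4) powr \<alpha>} t *
            (\<integral>\<^sup>+u. indicator {0<..<1} u * indicator {..(\<epsilon> / 4) powr \<beta>} u \<partial>lborel) \<partial>lborel)"
      by (subst nn_integral_cmult[symmetric]) (simp_all add: G_def mult_ac nn_integral_cmult)
    also have "\<dots> = ennreal ((\<epsilon> / 4) powr \<alpha>) * ennreal ((\<epsilon> / 4) powr \<beta>)"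
      using le1 by (simp add: nn_integral_multc nn_integral_indicator_initial)
    moreover have "(\<integral>\<^sup>+t. indicator {0<..<1} t * (\<integral>\<^sup>+u. indicator {0<..<1} u * G k0 t u \<partial>lborel) \<partial>lborel)
       = ennreal ((\<epsilon> / 4) powr \<beta>)"
      using le1 by (simp add: G_def nn_integral_multc nn_integral_indicator_initial)
    ultimately show ?thesis by simp
  qed
  also have "\<dots> = (\<Prod>i\<in>UNIV. \<integral>\<^sup>+t. indicator (unit_box i) t *
        (\<integral>\<^sup>+u. indicator (unit_box i) u * G i t u \<partial>lborel) \<partial>lborel)"
    unfolding unit_box_def
    by (rule prod_eq_pair[symmetric]) (auto simp: G_def)
  also have "\<dots> \<le> pair_integral \<mu>\<^sub>A \<mu>\<^sub>B (strip_indicator \<epsilon>)"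
    unfolding \<mu>\<^sub>A_def \<mu>\<^sub>B_def
  proof (rule pair_integral_box_image_ge)
    fix v w :: "'n \<Rightarrow> real"
    assume vw: "\<And>i. v i \<in> unit_box i" "\<And>i. w i \<in> unit_box i"
    then have pos: "0 < v i" "0 < w i" "v i < 1" for i by (simp_all add: unit_box_def)
    let ?t = "v e powr (1 / \<alpha>)" and ?u = "w e powr (1 / \<beta>)" and ?y = "w k0 powr (1 / \<beta>)"
    have "strip_indicator \<epsilon> (\<phi>\<^sub>A v) (\<phi>\<^sub>B w) = 1"
      if "v e \<le> (\<epsilon> / 4) powr \<alpha>" "w e \<le> (\<epsilon> / 4) powr \<beta>" "w k0 \<le> (\<epsilon> / 4) powr \<beta>"
    proof (rule strip_indicator_eq_1)
      have le: "?t \<le> \<epsilon> / 4" "?u \<le> \<epsilon> / 4" "?y \<le> \<epsilon> / 4"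
        using that pos \<epsilon> \<alpha> \<beta> by (intro iffD2[OF powr_inverse_le_iff]; simp)+
      have "?t * ?u \<le> \<epsilon> / 4 * 1" using le \<epsilon> by (intro mult_mono) auto
      moreover have "v k0 * ?y / d \<le> \<epsilon> / 4"
      proof -
        have "v k0 * ?y / d \<le> 1 * ?y / 1"
          using pos[of k0] d_gt_1 by (intro frac_le mult_right_mono) auto
        with le show ?thesis by linarith
      qed
      moreover have "(1 + ?t) * (1 + ?u) = 1 + ?t + ?u + ?t * ?u" by (simp add: algebra_simps)
      ultimately show "\<phi>\<^sub>A v \<bullet> \<phi>\<^sub>B w \<le> 1 + \<epsilon>" unfolding inner_AB using le by linarith
      have "0 \<le> v k0 * ?y / d" "0 \<le> ?t * ?u" "0 \<le> ?t" "0 \<le> ?u" using pos[of k0] d_gt_1 by simp_all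
      then show "1 \<le> \<phi>\<^sub>A v \<bullet> \<phi>\<^sub>B w" unfolding inner_AB
        using \<open>(1 + ?t) * (1 + ?u) = 1 + ?t + ?u + ?t * ?u\<close> by linarith
    qed
    moreover have "(\<Prod>i\<in>UNIV. G i (v i) (w i)) = G e (v e) (w e) * G k0 (v k0) (w k0)"
      by (rule prod_eq_pair) (auto simp: G_def)
    ultimately show "(\<Prod>i\<in>UNIV. G i (v i) (w i)) \<le> strip_indicator \<epsilon> (\<phi>\<^sub>A v) (\<phi>\<^sub>B w)"
      by (auto simp: G_def indicator_def)
  qed measurable
  finally show ?thesis .
qed

text \<open>All parameters with \<open>v l0\<close> between 1 and
  \<open>(\<epsilon> / (64 + d)) powr \<gamma>\<close> land in the strip: \<open>inner_DA_le\<close>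
  gives the upper end and \<open>inner_D_ge\<close> the lower one. This has content for large
  \<open>\<epsilon>\<close>.\<close>

lemma strip_DA_ge:
  assumes \<epsilon>: "0 < \<epsilon>"
  shows "ennreal ((\<epsilon> / (64 + d)) powr \<gamma> - 1) \<le> pair_integral \<mu>\<^sub>D \<mu>\<^sub>A (strip_indicator \<epsilon>)"
proof -
  define T where "T = (\<epsilon> / (64 + d)) powr \<gamma>"
  define G :: "'n \<Rightarrow> real \<Rightarrow> real \<Rightarrow> ennreal" where
    "G i t u = (if i = l0 then indicator {..T} t else 1)" for i t u
  have mG [measurable]: "case_prod (G i) \<in> borel_measurable (borel \<Otimes>\<^sub>M borel)" for i
    unfolding G_def split_beta' by (cases "i = l0"; simp)
  have "ennreal (T - 1) = (\<Prod>i\<in>UNIV. \<integral>\<^sup>+t. indicator (tail_box i) t *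
        (\<integral>\<^sup>+u. indicator (unit_box i) u * G i t u \<partial>lborel) \<partial>lborel)"
    by (subst prod_eq_single[of l0])
       (auto simp: G_def tail_box_def unit_box_def nn_integral_multc nn_integral_indicator_tail)
  also have "\<dots> \<le> pair_integral \<mu>\<^sub>D \<mu>\<^sub>A (strip_indicator \<epsilon>)"
    unfolding \<mu>\<^sub>D_def \<mu>\<^sub>A_def
  proof (rule pair_integral_box_image_ge)
    fix v w :: "'n \<Rightarrow> real"
    assume v: "\<And>i. v i \<in> tail_box i" and "\<And>i. w i \<in> unit_box i"
    then have w: "w i \<in> {0<..<1}" for i by (simp add: unit_box_def)
    let ?V = "v l0 powr (1 / \<gamma>)"
    have v1: "1 < v l0" using v[of l0] by (simp add: tail_box_def)
    have V: "1 \<le> ?V" using v1 \<gamma> by (intro ge_one_powr_ge_zero) auto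
    have "strip_indicator \<epsilon> (\<phi>\<^sub>D v) (\<phi>\<^sub>A w) = 1" if "v l0 \<le> T"
    proof (rule strip_indicator_eq_1)
      have "?V \<le> \<epsilon> / (64 + d)"
        using that v1 \<epsilon> d_gt_1 \<gamma> by (subst powr_inverse_le_iff) (auto simp: T_def)
      then have "(64 + d) * ?V \<le> \<epsilon>" using d_gt_1 by (simp add: field_simps)
      with inner_DA_le[of v w] v w show "\<phi>\<^sub>D v \<bullet> \<phi>\<^sub>A w \<le> 1 + \<epsilon>" by simp
      have "2 * ?V \<le> \<phi>\<^sub>D v \<bullet> \<phi>\<^sub>A w"
        by (intro inner_D_ge v bounds_A w order_trans[OF _ bounds_A(3)]) simp
      with V show "1 \<le> \<phi>\<^sub>D v \<bullet> \<phi>\<^sub>A w" by simp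
    qed
    moreover have "(\<Prod>i\<in>UNIV. G i (v i) (w i)) = G l0 (v l0) (w l0)"
      by (rule prod_eq_single) (simp add: G_def)
    ultimately show "(\<Prod>i\<in>UNIV. G i (v i) (w i)) \<le> strip_indicator \<epsilon> (\<phi>\<^sub>D v) (\<phi>\<^sub>A w)"
      by (auto simp: G_def indicator_def)
  qed measurable
  finally show ?thesis by (simp add: T_def)
qed

end

section \<open>Kernel bounds, energies of power laws and a divergent quotient\<close>

lemma riesz_kernel_leI:
  assumes "0 < r" "r \<le> norm (x - y)" "0 \<le> s"
  shows "riesz_kernel s x y \<le> ennreal (r powr (- s))"
  using assms by (auto simp: riesz_kernel_def intro!: ennreal_leI powr_mono2')

lemma riesz_kernel_geI:
  assumes "norm (x - y) \<le> R" "0 \<le> s"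
  shows "ennreal (R powr (- s)) \<le> riesz_kernel s x y"
  using assms by (auto simp: riesz_kernel_def intro!: ennreal_leI powr_mono2')

text \<open>The image concentrates like \<open>r powr (1 / a)\<close> at one point only, which both
  variables must approach; therefore exponents up to \<open>2 / a\<close> are allowed. This is the
  source of the terms \<open>2 * \<alpha>\<close> and \<open>4 * \<beta>\<close> in the
  locale.\<close>

lemma riesz_energy_power:
  fixes g :: "real \<Rightarrow> real"
  assumes "g \<in> borel_measurable borel" "c > 0" "1 \<le> a" "0 < \<sigma>" "\<sigma> < 1" "a * \<sigma> < 2"
    and g: "\<And>t. 0 < t \<Longrightarrow> g t = c * t powr a + b"
  shows "(\<integral>\<^sup>+t. indicator {0<..<1} t *
     (\<integral>\<^sup>+u. indicator {0<..<1} u * riesz_kernel \<sigma> (g t) (g u) \<partial>lborel) \<partial>lborel) < \<infinity>"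
proof (rule riesz_energy_unit_interval[where \<kappa> = c and a = a])
  fix v w :: real
  assume vw: "0 < w" "w < v" "v < 1"
  have "c * (v powr (a - 1) * (v - w)) \<le> c * (v powr a - w powr a)"
    using assms vw by (intro mult_left_mono powr_diff_ge) auto
  then show "c * v powr (a - 1) * (v - w) \<le> \<bar>g v - g w\<bar>"
    using vw by (simp add: g algebra_simps)
qed (use assms in auto)

lemma Limsup_inverse_mult_eq_infinity:
  fixes F :: "real \<Rightarrow> ennreal"
  assumes "c > 0" "\<gamma> < 1" and F: "\<And>\<epsilon>. \<epsilon> > 0 \<Longrightarrow> ennreal (c * \<epsilon> powr \<gamma>) \<le> F \<epsilon>"
  shows "Limsup (at_right 0) (\<lambda>\<epsilon>. ennreal (inverse \<epsilon>) * F \<epsilon>) = \<infinity>"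
proof -
  have "of_nat n \<le> Limsup (at_right 0) (\<lambda>\<epsilon>. ennreal (inverse \<epsilon>) * F \<epsilon>)" for n
  proof (rule le_Limsup)
    \<comment> \<open>Chosen so that \<open>(n + 1) * \<delta> powr (1 - \<gamma>) = c\<close>; the
      summand 1 avoids division by 0.\<close>
    define \<delta> where "\<delta> = (c / (real n + 1)) powr (1 / (1 - \<gamma>))"
    have "\<delta> > 0" using assms(1) by (simp add: \<delta>_def)
    then have "\<forall>\<^sub>F \<epsilon> in at_right 0. \<epsilon> \<in> {0<..<\<delta>}" by (rule eventually_at_right_real)
    then show "\<forall>\<^sub>F \<epsilon> in at_right 0. of_nat n \<le> ennreal (inverse \<epsilon>) * F \<epsilon>"
    proof eventually_elim
      case (elim \<epsilon>)
      then have \<epsilon>: "0 < \<epsilon>" "\<epsilon> < \<delta>" by auto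
      have "\<epsilon> powr (1 - \<gamma>) \<le> \<delta> powr (1 - \<gamma>)" using \<epsilon> assms(2) by (intro powr_mono2) auto
      also have "\<dots> = c / (real n + 1)" using assms by (simp add: \<delta>_def powr_powr)
      finally have "(real n + 1) * \<epsilon> powr (1 - \<gamma>) \<le> c" by (simp add: field_simps)
      then have "(real n + 1) * \<epsilon> powr (1 - \<gamma>) * \<epsilon> powr \<gamma> \<le> c * \<epsilon> powr \<gamma>"
        by (intro mult_right_mono) auto
      then have "(real n + 1) * \<epsilon> \<le> c * \<epsilon> powr \<gamma>"
        using \<epsilon> by (simp add: mult.assoc powr_add[symmetric])
      then have "real n \<le> inverse \<epsilon> * (c * \<epsilon> powr \<gamma>)" using \<epsilon> by (simp add: field_simps)
      then have "of_nat n \<le> ennreal (inverse \<epsilon>) * ennreal (c * \<epsilon> powr \<gamma>)"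
        using \<epsilon> assms(1)
        by (simp add: ennreal_mult[symmetric] ennreal_of_nat_eq_real_of_nat ennreal_leI)
      also have "\<dots> \<le> ennreal (inverse \<epsilon>) * F \<epsilon>" using F[OF \<epsilon>(1)] by (intro mult_left_mono) auto
      finally show ?case .
    qed
  qed simp
  then show ?thesis
    using ennreal_Ex_less_of_nat[of "Limsup (at_right 0) (\<lambda>\<epsilon>. ennreal (inverse \<epsilon>) * F \<epsilon>)"]
    by (metis infinity_ennreal_def leD less_top)
qed

subsection \<open>Finiteness of the energy\<close>

context strip_example
begin

lemma s_pos: "s > 0"
  using s_gt_half by simp

lemma d_ge_2: "d \<ge> 2"
proof -
  have "card {e, l0} \<le> CARD('n)" by (rule card_mono) auto
  then show ?thesis by (simp add: d)
qed

text \<open>The exponent is split in proportion to the weights 1 for each coordinate in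
  \<open>K\<close> and \<open>2 * \<alpha>\<close> for \<open>e\<close>. The common factor
  \<open>\<tau>\<close> is below 1 by the hypothesis on \<open>s\<close>, and in \<open>e\<close>
  the criterion \<open>a * \<sigma> < 2\<close> becomes \<open>2 * \<tau> < 2\<close>.\<close>

lemma energy_AA: "pair_integral \<mu>\<^sub>A \<mu>\<^sub>A (riesz_kernel s) < \<infinity>"
proof -
  define \<tau> where "\<tau> = s / (real (card K) + 2 * \<alpha>)"
  have \<tau>: "0 < \<tau>" "\<tau> < 1" "\<tau> * (real (card K) + 2 * \<alpha>) = s"
    using s(1) s_pos by (simp_all add: \<tau>_def)
  have \<alpha>\<tau>: "2 * \<alpha> * \<tau> < 1"
  proof -
    have "(2 * \<alpha>) * \<tau> \<le> 1 * \<tau>" using \<tau> \<alpha> by (intro mult_right_mono) auto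
    with \<tau>(2) show ?thesis by linarith
  qed
  show ?thesis
    unfolding \<mu>\<^sub>A_def
  proof (rule riesz_energy_box_image[where J = "insert e K"
        and \<sigma> = "\<lambda>i. if i = e then 2 * \<alpha> * \<tau> else \<tau>"
        and g = "\<lambda>i t. if i = e then 4 * (1 + t powr (1 / \<alpha>)) else t"])
    have "(\<Sum>i\<in>K. if i = e then 2 * \<alpha> * \<tau> else \<tau>) = (\<Sum>i\<in>K. \<tau>)"
      by (intro sum.cong) auto
    then show "(\<Sum>i\<in>insert e K. if i = e then 2 * \<alpha> * \<tau> else \<tau>) = s"
      using \<tau>(3) by (simp add: algebra_simps)
    fix i assume "i \<in> insert e K"
    then show "(\<integral>\<^sup>+t. indicator (unit_box i) t * (\<integral>\<^sup>+u. indicator (unit_box i) u *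
        riesz_kernel (if i = e then 2 * \<alpha> * \<tau> else \<tau>)
          (if i = e then 4 * (1 + t powr (1 / \<alpha>)) else t)
          (if i = e then 4 * (1 + u powr (1 / \<alpha>)) else u) \<partial>lborel) \<partial>lborel) < \<infinity>"
      using \<tau> \<alpha> \<alpha>\<tau> riesz_energy_power[of "\<lambda>t. 4 * (1 + t powr (1 / \<alpha>))" 4 "1 / \<alpha>" "2 * \<alpha> * \<tau>" 4]
        riesz_energy_power[of "\<lambda>t. t" 1 1 \<tau> 0]
      by (simp add: unit_box_def)
  qed (use \<tau> \<alpha> in \<open>auto simp: \<phi>\<^sub>A_def unit_box_def split: if_splits\<close>)
qed

text \<open>As for the first piece, with weight \<open>2 * \<beta>\<close> for both \<open>e\<close>
  and \<open>k0\<close> and weight 1 on \<open>L\<close>.\<close>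

lemma energy_BB: "pair_integral \<mu>\<^sub>B \<mu>\<^sub>B (riesz_kernel s) < \<infinity>"
proof -
  define \<tau> where "\<tau> = s / (real (card L) + 4 * \<beta>)"
  define \<sigma> where "\<sigma> i = (if i \<in> {e, k0} then 2 * \<beta> * \<tau> else \<tau>)" for i
  define g where "g i t = (if i = e then (1 + t powr (1 / \<beta>)) / 4
      else if i = k0 then t powr (1 / \<beta>) / d else t / d)" for i t
  have \<tau>: "0 < \<tau>" "\<tau> < 1" "\<tau> * (real (card L) + 4 * \<beta>) = s"
    using s(2) s_pos by (simp_all add: \<tau>_def)
  have \<beta>\<tau>: "2 * \<beta> * \<tau> < 1"
  proof -
    have "(2 * \<beta>) * \<tau> \<le> 1 * \<tau>" using \<tau> \<beta> by (intro mult_right_mono) auto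
    with \<tau>(2) show ?thesis by linarith
  qed
  show ?thesis
    unfolding \<mu>\<^sub>B_def
  proof (rule riesz_energy_box_image[where J = "insert e (insert k0 L)" and \<sigma> = \<sigma> and g = g])
    have "(\<Sum>i\<in>L. \<sigma> i) = (\<Sum>i\<in>L. \<tau>)"
      by (intro sum.cong) (auto simp: \<sigma>_def)
    then have "(\<Sum>i\<in>insert e (insert k0 L). \<sigma> i) = \<sigma> e + (\<sigma> k0 + real (card L) * \<tau>)"
      by simp
    then show "(\<Sum>i\<in>insert e (insert k0 L). \<sigma> i) = s"
      using \<tau>(3) by (simp add: \<sigma>_def algebra_simps)
    fix i
    show m: "g i \<in> borel_measurable borel"
      unfolding g_def by measurable
    assume i: "i \<in> insert e (insert k0 L)"
    from i consider "i = e" | "i = k0" | "i \<in> L" by blast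
    then have "(\<integral>\<^sup>+t. indicator {0<..<1} t * (\<integral>\<^sup>+u. indicator {0<..<1} u *
        riesz_kernel (\<sigma> i) (g i t) (g i u) \<partial>lborel) \<partial>lborel) < \<infinity>"
    proof cases
      case 1
      then show ?thesis
        using \<tau> \<beta> \<beta>\<tau>
        by (intro riesz_energy_power[OF m, of "1 / 4" "1 / \<beta>" "\<sigma> i" "1 / 4"]) (auto simp: \<sigma>_def g_def)
    next
      case 2
      then show ?thesis
        using \<tau> \<beta> \<beta>\<tau> d_gt_1
        by (intro riesz_energy_power[OF m, of "1 / d" "1 / \<beta>" "\<sigma> i" 0]) (auto simp: \<sigma>_def g_def)
    next
      case 3
      then have "i \<noteq> e" "i \<noteq> k0" by auto
      then show ?thesis
        using \<tau> d_gt_1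
        by (intro riesz_energy_power[OF m, of "1 / d" 1 "\<sigma> i" 0]) (auto simp: \<sigma>_def g_def)
    qed
    then show "(\<integral>\<^sup>+t. indicator (unit_box i) t * (\<integral>\<^sup>+u. indicator (unit_box i) u *
        riesz_kernel (\<sigma> i) (g i t) (g i u) \<partial>lborel) \<partial>lborel) < \<infinity>"
      by (simp only: unit_box_def)
  qed (use \<tau> \<beta> in \<open>auto simp: \<phi>\<^sub>B_def g_def \<sigma>_def unit_box_def split: if_splits\<close>)
qed

text \<open>All coordinates except \<open>e\<close> receive the same exponent, which lies strictly
  between 1/2 and 1.\<close>

lemma energy_DD: "pair_integral \<mu>\<^sub>D \<mu>\<^sub>D (riesz_kernel s) < \<infinity>"
proof -
  define \<tau> where "\<tau> = s / (d - 1)"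
  have \<tau>: "1 / 2 < \<tau>" "\<tau> < 1" "(d - 1) * \<tau> = s"
    using s(3,4) d_gt_1 by (simp_all add: \<tau>_def field_simps)
  show ?thesis
    unfolding \<mu>\<^sub>D_def
  proof (rule riesz_energy_box_image[where J = "- {e}" and \<sigma> = "\<lambda>_. \<tau>"
        and g = "\<lambda>i t. if i = l0 then t powr 4 else t"])
    show "(\<Sum>i\<in>- {e}. \<tau>) = s"
      using \<tau>(3) d d_gt_1 by (simp add: Compl_eq_Diff_UNIV of_nat_diff)
    have "l0 \<in> - {e}" by simp
    then show "- {e} \<noteq> {}" by blast
    fix i
    have "(\<integral>\<^sup>+t. indicator {1<..} t * (\<integral>\<^sup>+u. indicator {1<..} u *
        riesz_kernel \<tau> (t powr 4) (u powr (4 :: real)) \<partial>lborel) \<partial>lborel) < \<infinity>"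
    \<comment> \<open>On the unbounded side convergence requires \<open>1 - 4 * \<tau> < -1\<close>,
      that is \<open>\<tau> > 1 / 2\<close>; this is why coordinate \<open>l0\<close> carries the
      fourth power.\<close>
    proof (rule riesz_energy_line[where \<kappa> = 1 and a = 4])
      show "(\<integral>\<^sup>+v. indicator {1<..} v * ennreal (v powr (1 - 4 * \<tau>)) \<partial>lborel) < \<infinity>"
        using \<tau> by (intro nn_integral_powr_to_inf) auto
      fix v w :: real assume "v \<in> {1<..}" "w \<in> {1<..}" "w < v"
      then show "1 * v powr (4 - 1) * (v - w) \<le> \<bar>v powr 4 - w powr 4\<bar>"
        using powr_diff_ge[of 4 w v] by simp
    qed (use \<tau> in auto)
    then show "(\<integral>\<^sup>+t. indicator (tail_box i) t * (\<integral>\<^sup>+u. indicator (tail_box i) u *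
        riesz_kernel \<tau> (if i = l0 then t powr 4 else t) (if i = l0 then u powr 4 else u) \<partial>lborel) \<partial>lborel) < \<infinity>"
      using \<tau> riesz_energy_power[of "\<lambda>t. t" 1 1 \<tau> 0]
      by (simp add: tail_box_def)
  qed (use \<tau> in \<open>auto simp: \<phi>\<^sub>D_def tail_box_def split: if_splits\<close>)
qed

text \<open>The pieces are separated in \<open>e\<close>: at least 4 on the first, at most 1 on the
  second.\<close>

lemma energy_AB: "pair_integral \<mu>\<^sub>A \<mu>\<^sub>B (riesz_kernel s) \<le> 1"
  unfolding \<mu>\<^sub>A_def \<mu>\<^sub>B_def
proof (rule pair_integral_unit_box_le)
  fix v w :: "'n \<Rightarrow> real"
  assume vw: "\<And>i. v i \<in> {0<..<1}" "\<And>i. w i \<in> {0<..<1}"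
  have "1 \<le> \<phi>\<^sub>A v $ e - \<phi>\<^sub>B w $ e" using bounds_A(3)[of v] bounds_B(2)[of w e] vw by simp
  also have "\<dots> \<le> norm (\<phi>\<^sub>A v - \<phi>\<^sub>B w)"
    using component_le_norm_cart[of "\<phi>\<^sub>A v - \<phi>\<^sub>B w" e] by simp
  finally show "riesz_kernel s (\<phi>\<^sub>A v) (\<phi>\<^sub>B w) \<le> 1"
    using riesz_kernel_leI[of 1 "\<phi>\<^sub>A v" "\<phi>\<^sub>B w" s] s_pos by simp
qed measurable

text \<open>Coordinate \<open>l0\<close> alone gives distance at least half the fourth power of
  \<open>v l0\<close>. As \<open>s > 1 / 2\<close>, the kernel decays at least like
  \<open>v l0 powr (- 2)\<close>, which is integrable at infinity.\<close>

lemma energy_D: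
  fixes \<psi> :: "('n \<Rightarrow> real) \<Rightarrow> real ^ 'n"
  assumes [measurable]: "\<psi> \<in> measurable coords borel"
    and \<psi>: "\<And>w. (\<And>i. w i \<in> {0<..<1}) \<Longrightarrow> \<psi> w $ l0 \<le> 1 / 2"
  shows "pair_integral \<mu>\<^sub>D (box_image unit_box \<psi>) (riesz_kernel s) < \<infinity>"
proof -
  define G :: "'n \<Rightarrow> real \<Rightarrow> real \<Rightarrow> ennreal" where
    "G i t u = (if i = l0 then ennreal (2 powr s) * ennreal (t powr (- 2)) else 1)" for i t u
  have mG [measurable]: "case_prod (G i) \<in> borel_measurable (borel \<Otimes>\<^sub>M borel)" for i
    unfolding G_def split_beta' by (cases "i = l0"; simp)
  have "pair_integral \<mu>\<^sub>D (box_image unit_box \<psi>) (riesz_kernel s) \<le>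
     (\<Prod>i\<in>UNIV. \<integral>\<^sup>+t. indicator (tail_box i) t *
        (\<integral>\<^sup>+u. indicator (unit_box i) u * G i t u \<partial>lborel) \<partial>lborel)"
    unfolding \<mu>\<^sub>D_def
  proof (rule pair_integral_box_image_le)
    fix v w :: "'n \<Rightarrow> real"
    assume v: "\<And>i. v i \<in> tail_box i" and w: "\<And>i. w i \<in> unit_box i"
    have v1: "1 < v l0" using v[of l0] by (simp add: tail_box_def)
    have "1 \<le> v l0 powr 4" using v1 by (intro ge_one_powr_ge_zero) auto
    then have "v l0 powr 4 / 2 \<le> v l0 powr 4 - \<psi> w $ l0"
      using \<psi>[of w] w by (simp add: unit_box_def)
    also have "\<dots> \<le> norm (\<phi>\<^sub>D v - \<psi> w)"
      using component_le_norm_cart[of "\<phi>\<^sub>D v - \<psi> w" l0] by (simp add: \<phi>\<^sub>D_def)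
    finally have "riesz_kernel s (\<phi>\<^sub>D v) (\<psi> w) \<le> ennreal ((v l0 powr 4 / 2) powr (- s))"
      using v1 s_pos by (intro riesz_kernel_leI) auto
    also have "(v l0 powr 4 / 2) powr (- s) = 2 powr s * v l0 powr (- 4 * s)"
    proof -
      have "(v l0 powr 4 / 2) powr (- s) = (v l0 powr 4) powr (- s) / 2 powr (- s)"
        by (rule powr_divide)
      also have "(v l0 powr 4) powr (- s) = v l0 powr (- 4 * s)"
        by (simp add: powr_powr del: powr_numeral)
      finally show ?thesis by (simp only: powr_minus divide_inverse inverse_inverse_eq mult.commute)
    qed
    also have "\<dots> \<le> 2 powr s * v l0 powr (- 2)"
      using v1 s_gt_half by (intro mult_left_mono powr_mono) auto
    also have "ennreal (2 powr s * v l0 powr (- 2)) = G l0 (v l0) (w l0)"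
      by (simp add: G_def ennreal_mult)
    also have "\<dots> = (\<Prod>i\<in>UNIV. G i (v i) (w i))"
      by (rule prod_eq_single[symmetric]) (simp add: G_def)
    finally show "riesz_kernel s (\<phi>\<^sub>D v) (\<psi> w) \<le> (\<Prod>i\<in>UNIV. G i (v i) (w i))"
      by (simp add: ennreal_leI)
  qed measurable
  also have "\<dots> = (\<integral>\<^sup>+t. ennreal (2 powr s) * (indicator {1<..} t * ennreal (t powr (- 2))) \<partial>lborel)"
    by (subst prod_eq_single[of l0])
       (auto simp: G_def tail_box_def unit_box_def nn_integral_multc mult_ac)
  also have "\<dots> < \<infinity>"
    using nn_integral_powr_to_inf[of "- 2"] by (simp add: nn_integral_cmult ennreal_mult_less_top)
  finally show ?thesis .
qed

text \<open>The first piece has mass 1 and coordinates in \<open>[0, 8]\<close>, so distances in it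
  are at most \<open>8 * d\<close>.\<close>

lemma energy_AA_ge: "ennreal ((8 * d) powr (- s)) \<le> pair_integral \<mu>\<^sub>A \<mu>\<^sub>A (riesz_kernel s)"
  unfolding \<mu>\<^sub>A_def
proof (rule pair_integral_unit_box_ge)
  fix v w :: "'n \<Rightarrow> real"
  assume vw: "\<And>i. v i \<in> {0<..<1}" "\<And>i. w i \<in> {0<..<1}"
  have "norm (\<phi>\<^sub>A v - \<phi>\<^sub>A w) \<le> (\<Sum>i\<in>UNIV. \<bar>(\<phi>\<^sub>A v - \<phi>\<^sub>A w) $ i\<bar>)"
    by (rule norm_le_l1_cart)
  also have "\<dots> \<le> (\<Sum>i\<in>(UNIV :: 'n set). 8)"
  proof (rule sum_mono)
    fix i
    show "\<bar>(\<phi>\<^sub>A v - \<phi>\<^sub>A w) $ i\<bar> \<le> 8"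
      using bounds_A(1,2)[of v i] bounds_A(1,2)[of w i] vw by (simp add: abs_le_iff)
  qed
  finally show "ennreal ((8 * d) powr (- s)) \<le> riesz_kernel s (\<phi>\<^sub>A v) (\<phi>\<^sub>A w)"
    using s_pos by (intro riesz_kernel_geI) (auto simp: d)
qed measurable

lemma riesz_energy_\<mu>: "0 < riesz_energy s \<mu>" "riesz_energy s \<mu> < \<infinity>"
proof -
  have eq: "riesz_energy s \<mu> = pair_integral \<mu> \<mu> (riesz_kernel s)"
    by (simp add: riesz_energy_def pair_integral_def)
  note exp = pair_integral_\<mu>[of "riesz_kernel s", OF measurable_riesz_kernel riesz_kernel_commute]
  have "0 < ennreal ((8 * d) powr (- s))" using d_gt_1 by simp
  also note energy_AA_ge
  also have "pair_integral \<mu>\<^sub>A \<mu>\<^sub>A (riesz_kernel s) \<le> riesz_energy s \<mu>"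
    unfolding eq exp by (simp add: add.assoc)
  finally show "0 < riesz_energy s \<mu>" .
  have DA: "pair_integral \<mu>\<^sub>D \<mu>\<^sub>A (riesz_kernel s) < \<infinity>"
    unfolding \<mu>\<^sub>A_def by (rule energy_D) (simp_all add: bounds_A)
  have DB: "pair_integral \<mu>\<^sub>D \<mu>\<^sub>B (riesz_kernel s) < \<infinity>"
    unfolding \<mu>\<^sub>B_def
  proof (rule energy_D)
    fix w :: "'n \<Rightarrow> real"
    assume "\<And>i. w i \<in> {0<..<1}"
    then have "w l0 < 1" "0 < w l0" by auto
    then have "w l0 / d \<le> 1 / 2" using d_ge_2 by (intro frac_le) auto
    then show "\<phi>\<^sub>B w $ l0 \<le> 1 / 2" by (simp add: \<phi>\<^sub>B_def)
  qed simp
  have AB: "pair_integral \<mu>\<^sub>A \<mu>\<^sub>B (riesz_kernel s) < \<infinity>"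
    using energy_AB by (rule le_less_trans) simp
  show "riesz_energy s \<mu> < \<infinity>"
    unfolding eq exp using energy_AA AB energy_BB DA DB energy_DD
    by (simp add: ennreal_mult_less_top)
qed

section \<open>Two-sided bounds for the total strip mass\<close>

lemma strip_\<mu>_le:
  assumes "\<epsilon> > 0"
  shows "pair_integral \<mu> \<mu> (strip_indicator \<epsilon>) \<le> ennreal ((6 + 4 * d) * \<epsilon> powr \<gamma>)"
proof -
  have DA: "pair_integral \<mu>\<^sub>D \<mu>\<^sub>A (strip_indicator \<epsilon>) \<le> ennreal (\<epsilon> powr \<gamma>)"
    unfolding \<mu>\<^sub>A_def
  proof (rule strip_D_le)
    fix w :: "'n \<Rightarrow> real"
    assume "\<And>i. w i \<in> {0<..<1}"
    then have "4 \<le> \<phi>\<^sub>A w $ e" by (rule bounds_A)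
    then show "1 / 4 \<le> \<phi>\<^sub>A w $ e" by simp
  qed (auto intro: assms bounds_A)
  have DB: "pair_integral \<mu>\<^sub>D \<mu>\<^sub>B (strip_indicator \<epsilon>) \<le> ennreal (\<epsilon> powr \<gamma>)"
    unfolding \<mu>\<^sub>B_def
  proof (rule strip_D_le)
    fix w :: "'n \<Rightarrow> real"
    assume "\<And>i. w i \<in> {0<..<1}"
    then show "1 / 4 \<le> \<phi>\<^sub>B w $ e" by (rule bounds_B)
  qed (auto intro: assms bounds_B)
  \<comment> \<open>The six terms give
    \<open>1 + 2 * (2 * d) + 0 + 2 * (1 + 1) + 1 = 6 + 4 * d\<close>.\<close>
  have "pair_integral \<mu> \<mu> (strip_indicator \<epsilon>) \<le> ennreal (\<epsilon> powr \<gamma>) +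
      ennreal 2 * ennreal (2 * d * \<epsilon> powr \<gamma>) + 0 +
      ennreal 2 * (ennreal (\<epsilon> powr \<gamma>) + ennreal (\<epsilon> powr \<gamma>)) + ennreal (\<epsilon> powr \<gamma>)"
    using strip_AA_le[OF assms] strip_AB_le[OF assms] strip_BB DA DB strip_DD_le[OF assms]
    by (subst pair_integral_\<mu>) (auto intro!: add_mono mult_left_mono strip_indicator_commute)
  also have "\<dots> = ennreal ((6 + 4 * d) * \<epsilon> powr \<gamma>)"
    using d_gt_1
    by (simp add: ennreal_mult[symmetric] ennreal_plus[symmetric] algebra_simps del: ennreal_plus ennreal_numeral)
  finally show ?thesis .
qed

lemma strip_indicator_mono:
  assumes "\<epsilon> \<le> \<epsilon>'"
  shows "strip_indicator \<epsilon> x y \<le> strip_indicator \<epsilon>' x y"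
  using assms by (auto simp: strip_indicator_def dot_product_strip_def indicator_def)

text \<open>Narrow strips are served by the first two pieces and wide ones by the unbounded piece
  with the first. In between, monotonicity in the width reduces to width 1.\<close>

lemma strip_\<mu>_ge:
  assumes \<epsilon>: "\<epsilon> > 0"
  shows "ennreal ((\<epsilon> / (16 * (64 + d))) powr \<gamma>) \<le> pair_integral \<mu> \<mu> (strip_indicator \<epsilon>)"
proof -
  let ?M = "64 + d" and ?F = "\<lambda>\<epsilon>. pair_integral \<mu> \<mu> (strip_indicator \<epsilon>)"
  have M: "?M > 1" using d_gt_1 by simp
  have two: "x \<le> 2 * x" for x :: ennreal by (simp add: mult_2)
  have exp: "?F \<epsilon> = pair_integral \<mu>\<^sub>A \<mu>\<^sub>A (strip_indicator \<epsilon>) + 2 * pair_integral \<mu>\<^sub>A \<mu>\<^sub>B (strip_indicator \<epsilon>)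
     + pair_integral \<mu>\<^sub>B \<mu>\<^sub>B (strip_indicator \<epsilon>)
     + 2 * (pair_integral \<mu>\<^sub>D \<mu>\<^sub>A (strip_indicator \<epsilon>) + pair_integral \<mu>\<^sub>D \<mu>\<^sub>B (strip_indicator \<epsilon>))
     + pair_integral \<mu>\<^sub>D \<mu>\<^sub>D (strip_indicator \<epsilon>)" for \<epsilon>
    by (rule pair_integral_\<mu>[OF measurable_strip_indicator strip_indicator_commute])
  have AB: "pair_integral \<mu>\<^sub>A \<mu>\<^sub>B (strip_indicator \<epsilon>) \<le> ?F \<epsilon>" for \<epsilon>
    unfolding exp by (intro add_increasing2 add_increasing two) simp_all
  have DA: "pair_integral \<mu>\<^sub>D \<mu>\<^sub>A (strip_indicator \<epsilon>) \<le> ?F \<epsilon>" for \<epsilon>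
    unfolding exp by (intro add_increasing2 add_increasing order_trans[OF _ two]) simp_all
  consider "\<epsilon> \<le> 1" | "1 \<le> \<epsilon>" "\<epsilon> \<le> 4 * ?M" | "4 * ?M \<le> \<epsilon>" by linarith
  then show ?thesis
  proof cases
    case 1
    have "(\<epsilon> / (16 * ?M)) powr \<gamma> \<le> (\<epsilon> / 4) powr \<gamma>"
      using \<epsilon> \<gamma> M by (intro powr_mono2 divide_left_mono) auto
    then show ?thesis
      using strip_AB_ge[OF \<epsilon> 1] AB by (meson ennreal_leI order_trans)
  next
    case 2
    \<comment> \<open>The factor 16 makes the bound for width 1,
      \<open>(1 / 4) powr \<gamma>\<close>, sufficient up to
      \<open>\<epsilon> = 4 * ?M\<close>.\<close>
    have "\<epsilon> / (16 * ?M) \<le> 1 / 4" using 2 M by (simp add: field_simps)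
    then have "(\<epsilon> / (16 * ?M)) powr \<gamma> \<le> (1 / 4) powr \<gamma>"
      using \<epsilon> \<gamma> M by (intro powr_mono2) auto
    moreover have "?F 1 \<le> ?F \<epsilon>"
      unfolding pair_integral_def using 2 by (intro nn_integral_mono strip_indicator_mono)
    ultimately show ?thesis
      using strip_AB_ge[of 1] AB[of 1] by (simp del: powr_divide) (meson ennreal_leI order_trans)
  next
    case 3
    let ?T = "(\<epsilon> / ?M) powr \<gamma>"
    have 16: "(1 / 16 :: real) powr \<gamma> \<le> 1 / 4"
    proof -
      have "(1 / 16 :: real) powr \<gamma> \<le> (1 / 16) powr (1 / 2)"
        using \<gamma> by (intro powr_mono') auto
      also have "\<dots> = 1 / 4" by (simp add: powr_half_sqrt real_sqrt_divide)
      finally show ?thesis .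
    qed
    \<comment> \<open>From \<open>2 \<le> ?T\<close> follows \<open>?T / 4 \<le> ?T - 1\<close>, and
      the factor \<open>(1 / 16) powr \<gamma>\<close> is at most 1/4.\<close>
    have "(4 :: real) powr (1 / 2) \<le> 4 powr \<gamma>" using \<gamma> by (intro powr_mono) auto
    also have "\<dots> \<le> ?T" using 3 M \<gamma> by (intro powr_mono2) (auto simp: field_simps)
    finally have T: "2 \<le> ?T" by (simp add: powr_half_sqrt)
    have "\<epsilon> / (16 * ?M) = \<epsilon> / ?M * (1 / 16)" by simp
    then have "(\<epsilon> / (16 * ?M)) powr \<gamma> = ?T * (1 / 16) powr \<gamma>"
      using \<epsilon> M by (simp only: powr_mult)
    also have "\<dots> \<le> ?T * (1 / 4)" using 16 by (intro mult_left_mono) auto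
    also have "\<dots> \<le> ?T - 1" using T by simp
    finally show ?thesis
      using strip_DA_ge[OF \<epsilon>] DA by (meson ennreal_leI order_trans)
  qed
qed

lemma strip_example_comparable:
  "\<exists>C>0. comparable C (riesz_energy s \<mu>) 1 \<and>
     (\<forall>\<epsilon>>0. comparable C (emeasure (\<mu> \<Otimes>\<^sub>M \<mu>) (dot_product_strip \<epsilon>)) (ennreal (\<epsilon> powr \<gamma>)))"
proof -
  obtain x where x: "riesz_energy s \<mu> = ennreal x" "0 < x"
    using riesz_energy_\<mu> by (cases "riesz_energy s \<mu>") auto
  define M where "M = 16 * (64 + d)"
  have M: "M > 0" using d_gt_1 by (simp add: M_def)
  \<comment> \<open>A sum of positive constants dominates each of them: two serve the energy and two
    the strips, so one \<open>C\<close> works for all widths.\<close>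
  define C where "C = x + 1 / x + (6 + 4 * d) + M powr \<gamma>"
  have C: "x \<le> C" "1 / x \<le> C" "6 + 4 * d \<le> C" "M powr \<gamma> \<le> C" "0 < C"
    using x(2) d_gt_1 by (simp_all add: C_def add_nonneg_nonneg add_pos_nonneg)
  have "1 \<le> C * x" using C(2) x(2) by (simp add: field_simps)
  then have "1 \<le> ennreal C * ennreal x"
    using C(5) x(2) by (simp add: ennreal_mult[symmetric])
  then have "comparable C (riesz_energy s \<mu>) 1"
    using C(1) by (simp add: comparable_def x(1) ennreal_leI)
  moreover have "comparable C (emeasure (\<mu> \<Otimes>\<^sub>M \<mu>) (dot_product_strip \<epsilon>)) (ennreal (\<epsilon> powr \<gamma>))"
    if \<epsilon>: "\<epsilon> > 0" for \<epsilon>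
    unfolding comparable_def emeasure_strip_eq[OF sets_components(4) sigma_finite_\<mu>]
  proof
    have "(6 + 4 * d) * \<epsilon> powr \<gamma> \<le> C * \<epsilon> powr \<gamma>" using C(3) by (intro mult_right_mono) auto
    then show "pair_integral \<mu> \<mu> (strip_indicator \<epsilon>) \<le> ennreal C * ennreal (\<epsilon> powr \<gamma>)"
      using strip_\<mu>_le[OF \<epsilon>] C(5)
      by (simp add: ennreal_mult[symmetric]) (meson ennreal_leI order_trans)
    have "\<epsilon> powr \<gamma> = M powr \<gamma> * (\<epsilon> / M) powr \<gamma>"
      using \<epsilon> M by (subst powr_mult[symmetric]) auto
    then have "ennreal (\<epsilon> powr \<gamma>) = ennreal (M powr \<gamma>) * ennreal ((\<epsilon> / M) powr \<gamma>)"
      by (simp add: ennreal_mult)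
    also have "\<dots> \<le> ennreal C * pair_integral \<mu> \<mu> (strip_indicator \<epsilon>)"
      using strip_\<mu>_ge[OF \<epsilon>] C(4) unfolding M_def[symmetric]
      by (intro mult_mono ennreal_leI) auto
    finally show "ennreal (\<epsilon> powr \<gamma>) \<le> ennreal C * pair_integral \<mu> \<mu> (strip_indicator \<epsilon>)" .
  qed
  ultimately show ?thesis using C(5) by blast
qed

lemma strip_example_Limsup:
  "Limsup (at_right 0) (\<lambda>\<epsilon>. ennreal (inverse \<epsilon>) * emeasure (\<mu> \<Otimes>\<^sub>M \<mu>) (dot_product_strip \<epsilon>)) = \<infinity>"
proof (rule Limsup_inverse_mult_eq_infinity)
  let ?M = "16 * (64 + d)"
  show "0 < (1 / ?M) powr \<gamma>" using d_gt_1 by simp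
  fix \<epsilon> :: real assume \<epsilon>: "\<epsilon> > 0"
  have "(1 / ?M) powr \<gamma> * \<epsilon> powr \<gamma> = (\<epsilon> / ?M) powr \<gamma>"
    using \<epsilon> d_gt_1 by (subst powr_mult[symmetric]) auto
  then show "ennreal ((1 / ?M) powr \<gamma> * \<epsilon> powr \<gamma>) \<le> emeasure (\<mu> \<Otimes>\<^sub>M \<mu>) (dot_product_strip \<epsilon>)"
    using strip_\<mu>_ge[OF \<epsilon>] by (simp add: emeasure_strip_eq sigma_finite_\<mu>)
qed (rule \<gamma>)

end

section \<open>Choice of the parameters\<close>

theorem theorem1p2:
  fixes s :: real
  assumes "CARD('n::finite) \<ge> 3"
    and "real CARD('n) / 2 < s" and "s < (real CARD('n) + 1) / 2"
  shows "\<exists>\<mu> :: (real ^ 'n) measure.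
           sets \<mu> = sets borel \<and> sigma_finite_measure \<mu> \<and>
           (\<exists>C>0. comparable C (riesz_energy s \<mu>) 1 \<and>
             (\<forall>\<epsilon>>0. comparable C (emeasure (\<mu> \<Otimes>\<^sub>M \<mu>) (dot_product_strip \<epsilon>))
                             (ennreal (\<epsilon> powr (2 * s / (real CARD('n) + 1)))))) \<and>
           Limsup (at_right 0)
             (\<lambda>\<epsilon>. ennreal (inverse \<epsilon>) * emeasure (\<mu> \<Otimes>\<^sub>M \<mu>) (dot_product_strip \<epsilon>)) = \<infinity>"
proof -
  \<comment> \<open>\<open>k\<close> is the size of \<open>K\<close>; then \<open>L\<close> has size
    \<open>k\<close> for odd dimension and \<open>k - 1\<close> for even dimension.\<close>
  define d k where "d = real CARD('n)" and "k = CARD('n) div 2"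
  define \<gamma> where "\<gamma> = 2 * s / (d + 1)"
  \<comment> \<open>\<open>\<alpha>\<close> and \<open>\<beta>\<close> solve \<open>k + 2 * \<alpha>
    = (d - 1 - k) + 4 * \<beta> = \<gamma> + (d - 1) / 2\<close>. Then
    \<open>\<alpha> + 2 * \<beta> = \<gamma>\<close>, and both energy conditions become
    \<open>s < \<gamma> + (d - 1) / 2\<close>.\<close>
  define \<alpha> where "\<alpha> = (\<gamma> + (d - 1) / 2 - real k) / 2"
  define \<beta> where "\<beta> = (\<gamma> - (d - 1) / 2 + real k) / 4"
  have d3: "d \<ge> 3" using assms(1) by (simp add: d_def)
  have k: "1 \<le> k" "k \<le> CARD('n) - 2" using assms(1) by (auto simp: k_def)
  have "2 * k \<le> CARD('n)" "CARD('n) \<le> 2 * k + 1" by (simp_all add: k_def)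
  then have "real (2 * k) \<le> d" "d \<le> real (2 * k + 1)" unfolding d_def by (simp_all only: of_nat_le_iff)
  then have kd: "real k \<le> d / 2" "(d - 1) / 2 \<le> real k" by simp_all
  have sd: "d / 2 < s" "s < (d + 1) / 2" using assms by (simp_all add: d_def)
  \<comment> \<open>Since \<open>k \<le> d / 2\<close>, a value of \<open>\<gamma>\<close> above 1/2
    makes \<open>\<alpha>\<close> positive.\<close>
  have "3 / 4 < \<gamma>"
  proof -
    have "3 / 4 * (d + 1) \<le> d" using d3 by (simp add: field_simps)
    also have "\<dots> < 2 * s" using sd by simp
    finally show ?thesis using d3 by (simp add: \<gamma>_def field_simps)
  qed
  moreover have "\<gamma> < 1" using sd d3 by (simp add: \<gamma>_def field_simps)
  \<comment> \<open>The difference of the two sides is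
    \<open>((d + 1) / 2 - s) * (d - 1) / (d + 1)\<close>, positive by the upper bound on
    \<open>s\<close>.\<close>
  moreover have gain: "s - (d - 1) / 2 < \<gamma>"
  proof -
    have "0 < ((d + 1) / 2 - s) * (d - 1)" using sd d3 by simp
    then have "(s - (d - 1) / 2) * (d + 1) < 2 * s" by (simp add: field_simps)
    then show ?thesis using d3 by (simp add: \<gamma>_def field_simps)
  qed
  ultimately have bounds: "1 / 2 \<le> \<gamma>" "\<gamma> < 1" "0 < \<alpha>" "\<alpha> \<le> 1 / 2" "0 < \<beta>" "\<beta> \<le> 1 / 2"
      "\<alpha> + 2 * \<beta> = \<gamma>"
    using kd by (simp_all add: \<alpha>_def \<beta>_def field_simps)
  obtain e :: 'n where True by simp
  have card_e: "card (- {e}) = CARD('n) - 1" by (simp add: Compl_eq_Diff_UNIV)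
  then have "k \<le> card (- {e})" using k by simp
  then obtain K where K: "K \<subseteq> - {e}" "card K = k" "finite K" by (rule obtain_subset_with_card_n)
  define L where "L = - {e} - K"
  have L: "card L = CARD('n) - 1 - k"
    unfolding L_def using K card_e by (simp add: card_Diff_subset)
  then have L': "real (card L) = d - 1 - real k" using k by (simp add: d_def of_nat_diff)
  obtain k0 where k0: "k0 \<in> K" using K(2) k by fastforce
  have "L \<noteq> {}" using L k assms(1) by auto
  then obtain l0 where l0: "l0 \<in> L" by blast
  interpret strip_example d s \<gamma> \<alpha> \<beta> K L e k0 l0
  proof
    show "K \<union> L = - {e}" "K \<inter> L = {}" using K by (auto simp: L_def)
    show "s < real (card K) + 2 * \<alpha>" "s < real (card L) + 4 * \<beta>"
      using gain by (simp_all add: K L' \<alpha>_def \<beta>_def field_simps)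
    show "(d - 1) / 2 < s" "s < d - 1" using sd d3 by simp_all
  qed (use bounds k0 l0 in \<open>simp_all add: d_def\<close>)
  have "2 * s / (real CARD('n) + 1) = \<gamma>" by (simp add: \<gamma>_def d_def)
  then show ?thesis
    using strip_example_comparable strip_example_Limsup sigma_finite_\<mu> by (intro exI[of _ \<mu>]) simp
qed

end
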